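(* Let $n\ge2$ and let $\varphi(z_1,\dots,z_n)=\sum_{j=1}^n\varphi_j(z_j)$ with each $\varphi_j:\mathbb C\to\mathbb R$ of class $C^\infty$. Suppose that there exists $\ell$ such that $A^2(\mathbb C,\varphi_\ell)$ is infinite dimensional. Suppose also that $1\in L^2(\mathbb C,\varphi_j)$ for all $j$. Suppose finally that for some $k\ne\ell$, $\overline z_k\in L^2(\mathbb C,\varphi_k)$. Then the canonical solution operator to $\overline\partial$ fails to be compact even on the space $A^2_{(0,1)}(\mathbb C^n,\varphi)$ (i.e. its restriction to $A^2_{(0,1)}(\mathbb C^n,\varphi)$, with values in $L^2(\mathbb C^n,\varphi)$, is not compact).
   Context: For a weight $\psi:\mathbb C^m\to\mathbb R$, $L^2(\mathbb C^m,\psi)$ is the Hilbert space of measurable $f:\mathbb C^m\to\mathbb C$ with $\int_{\mathbb C^m}|f|^2e^{-2\psi}\,d\lambda<\infty$, and $A^2(\mathbb C^m,\psi)$ is the subspace of entire functions belonging to $L^2(\mathbb C^m,\psi)$. $L^2_{(0,1)}(\mathbb C^n,\varphi)$ is the space of $(0,1)$-forms $\sum_j f_j\,d\overline z_j$ with coefficients in $L^2(\mathbb C^n,\varphi)$ (norm$^2$ $=\sum_j\|f_j\|^2$), and $A^2_{(0,1)}(\mathbb C^n,\varphi)$ is its subspace of forms with holomorphic coefficients. "$\overline z_k\in L^2(\mathbb C,\varphi_k)$" means that the function $z_k\mapsto\overline z_k$ on $\mathbb C$ belongs to $L^2(\mathbb C,\varphi_k)$. The canonical solution operator to $\overline\partial$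 maps a $\overline\partial$-closed form $f\in L^2_{(0,1)}(\mathbb C^n,\varphi)$, for which $\overline\partial u=f$ is solvable in $L^2(\mathbb C^n,\varphi)$, to the unique solution $u\in L^2(\mathbb C^n,\varphi)$ orthogonal to $\operatorname{Ker}\overline\partial=A^2(\mathbb C^n,\varphi)$. It is called compact on a space if the images of bounded sequences (in its domain within that space) have convergent subsequences. *)

theory Defs
  imports "HOL-Complex_Analysis.Complex_Analysis" "HOL-Library.Function_Algebras"
begin

section \<open>Smooth functions\<close>

fun C_k :: "nat \<Rightarrow> ('a::euclidean_space \<Rightarrow> 'b::real_normed_vector) \<Rightarrow> bool" where
  "C_k 0 f \<longleftrightarrow> continuous_on UNIV f"
| "C_k (Suc m) f \<longleftrightarrow>
     (\<forall>x. f differentiable (at x)) \<and> (\<forall>v. C_k m (\<lambda>x. frechet_derivative f (at x) v))"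

text \<open>Smoothness is in the real sense: for functions on \<open>\<complex>\<close> or \<open>\<complex>\<^sup>n\<close>,
  the directions \<^term>\<open>v\<close> range over the underlying real vector space.\<close>

definition C_infinity :: "('a::euclidean_space \<Rightarrow> 'b::real_normed_vector) \<Rightarrow> bool" where
  "C_infinity f \<longleftrightarrow> (\<forall>m. C_k m f)"

definition test_function :: "('a::euclidean_space \<Rightarrow> complex) \<Rightarrow> bool" where
  "test_function \<eta> \<longleftrightarrow> C_infinity \<eta> \<and> compact (closure {z. \<eta> z \<noteq> 0})"


section \<open>Weighted spaces of functions\<close>

text \<open>Elements of \<open>L\<^sup>2\<close> are functions rather than classes modulo almost-everywhere equality, so
  the norm below is a seminorm. The weight enters as \<open>e\<^sup>-\<^sup>2\<^sup>\<psi>\<close>.\<close>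

definition L2 :: "('a::euclidean_space \<Rightarrow> real) \<Rightarrow> ('a \<Rightarrow> complex) set" where
  "L2 \<psi> = {f. f \<in> borel_measurable lebesgue \<and>
              integrable lebesgue (\<lambda>z. (cmod (f z))\<^sup>2 * exp (- 2 * \<psi> z))}"

definition L2_inner ::
    "('a::euclidean_space \<Rightarrow> real) \<Rightarrow> ('a \<Rightarrow> complex) \<Rightarrow> ('a \<Rightarrow> complex) \<Rightarrow> complex" where
  "L2_inner \<psi> f g =
     integral\<^sup>L lebesgue (\<lambda>z. f z * cnj (g z) * complex_of_real (exp (- 2 * \<psi> z)))"

definition L2_norm :: "('a::euclidean_space \<Rightarrow> real) \<Rightarrow> ('a \<Rightarrow> complex) \<Rightarrow> real" where
  "L2_norm \<psi> f = sqrt (integral\<^sup>L lebesgue (\<lambda>z. (cmod (f z))\<^sup>2 * exp (- 2 * \<psi> z)))"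

text \<open>The space \<open>A\<^sup>2(\<complex>, \<psi>)\<close> of one-variable entire functions.\<close>

definition A2_1 :: "(complex \<Rightarrow> real) \<Rightarrow> (complex \<Rightarrow> complex) set" where
  "A2_1 \<psi> = {f \<in> L2 \<psi>. f holomorphic_on UNIV}"

text \<open>Holomorphy in several variables: the real Frechet derivative exists everywhere and is
  complex linear.\<close>

definition entire :: "(complex^'n::finite \<Rightarrow> complex) \<Rightarrow> bool" where
  "entire f \<longleftrightarrow>
     (\<forall>z. \<exists>D. (f has_derivative D) (at z) \<and> (\<forall>c v. D (c *s v) = c * D v))"

definition A2 :: "(complex^'n::finite \<Rightarrow> real) \<Rightarrow> (complex^'n \<Rightarrow> complex) set" where
  "A2 \<psi> = {f \<in> L2 \<psi>. entire f}"

text \<open>Dimension is over \<open>\<complex>\<close>, in the space of all functions. On spaces of continuous functions,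
  such as \<^const>\<open>A2_1\<close>, this is the dimension of the corresponding subspace of \<open>L\<^sup>2\<close>, because
  continuous functions that agree almost everywhere are equal.\<close>

definition infinite_dimensional :: "('a \<Rightarrow> complex) set \<Rightarrow> bool" where
  "infinite_dimensional V \<longleftrightarrow>
     \<not> (\<exists>B. finite B \<and> V \<subseteq> module.span (\<lambda>(c::complex) f z. c * f z) B)"

lemma vector_space_complex_functions:
  "vector_space (\<lambda>(c::complex) (f::'a \<Rightarrow> complex) z. c * f z)"
  by unfold_locales (auto simp: fun_eq_iff algebra_simps)


section \<open>Forms of bidegree (0,1)\<close>

text \<open>A form is represented by its family of coefficients, the \<open>j\<close>-th one being that of the
  conjugate of \<open>dz\<^sub>j\<close>.\<close>

type_synonym 'n form01 = "'n \<Rightarrow> complex^'n \<Rightarrow> complex"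

definition L2_01 :: "(complex^'n::finite \<Rightarrow> real) \<Rightarrow> 'n form01 set" where
  "L2_01 \<psi> = {f. \<forall>j. f j \<in> L2 \<psi>}"

definition L2_01_norm :: "(complex^'n::finite \<Rightarrow> real) \<Rightarrow> 'n form01 \<Rightarrow> real" where
  "L2_01_norm \<psi> f = sqrt (\<Sum>j\<in>UNIV. (L2_norm \<psi> (f j))\<^sup>2)"

definition A2_01 :: "(complex^'n::finite \<Rightarrow> real) \<Rightarrow> 'n form01 set" where
  "A2_01 \<psi> = {f \<in> L2_01 \<psi>. \<forall>j. entire (f j)}"


section \<open>The Cauchy-Riemann operator\<close>

text \<open>The Wirtinger derivative of \<open>f\<close> in the conjugate of the \<open>j\<close>-th variable, that is
  \<open>(\<partial>f/\<partial>x\<^sub>j + \<i> \<partial>f/\<partial>y\<^sub>j) / 2\<close>.\<close>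

definition dzbar :: "'n::finite \<Rightarrow> (complex^'n \<Rightarrow> complex) \<Rightarrow> complex^'n \<Rightarrow> complex" where
  "dzbar j f z =
     (frechet_derivative f (at z) (axis j 1)
       + \<i> * frechet_derivative f (at z) (axis j \<i>)) / 2"

text \<open>On \<open>L\<^sup>2\<close> the Cauchy-Riemann operator acts in the sense of distributions. For a continuous
  weight every element of \<^const>\<open>L2\<close> is locally integrable, so the integrals below converge.\<close>

definition dbar_eq :: "(complex^'n::finite \<Rightarrow> complex) \<Rightarrow> 'n form01 \<Rightarrow> bool" where
  "dbar_eq u f \<longleftrightarrow>
     (\<forall>j \<eta>. test_function \<eta> \<longrightarrow>
        integral\<^sup>L lebesgue (\<lambda>z. u z * dzbar j \<eta> z)
          = - integral\<^sup>L lebesgue (\<lambda>z. f j z * \<eta> z))"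

definition dbar_closed :: "'n::finite form01 \<Rightarrow> bool" where
  "dbar_closed f \<longleftrightarrow>
     (\<forall>i j \<eta>. test_function \<eta> \<longrightarrow>
        integral\<^sup>L lebesgue (\<lambda>z. f j z * dzbar i \<eta> z)
          = integral\<^sup>L lebesgue (\<lambda>z. f i z * dzbar j \<eta> z))"


section \<open>The canonical solution operator\<close>

definition canonical_domain :: "(complex^'n::finite \<Rightarrow> real) \<Rightarrow> 'n form01 set" where
  "canonical_domain \<psi> = {f \<in> L2_01 \<psi>. dbar_closed f \<and> (\<exists>u\<in>L2 \<psi>. dbar_eq u f)}"

definition is_canonical_solution ::
    "(complex^'n::finite \<Rightarrow> real) \<Rightarrow> 'n form01 \<Rightarrow> (complex^'n \<Rightarrow> complex) \<Rightarrow> bool" where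
  "is_canonical_solution \<psi> f u \<longleftrightarrow>
     u \<in> L2 \<psi> \<and> dbar_eq u f \<and> (\<forall>h\<in>A2 \<psi>. L2_inner \<psi> u h = 0)"

text \<open>As a function, the canonical solution is only unique up to almost-everywhere equality,
  hence the choice of a representative.\<close>

definition canonical_solution ::
    "(complex^'n::finite \<Rightarrow> real) \<Rightarrow> 'n form01 \<Rightarrow> complex^'n \<Rightarrow> complex" where
  "canonical_solution \<psi> f = (SOME u. is_canonical_solution \<psi> f u)"

definition canonical_solution_compact_on ::
    "(complex^'n::finite \<Rightarrow> real) \<Rightarrow> 'n form01 set \<Rightarrow> bool" where
  "canonical_solution_compact_on \<psi> V \<longleftrightarrow>
     (\<forall>F :: nat \<Rightarrow> 'n form01.
        (\<forall>m. F m \<in> V \<inter> canonical_domain \<psi>) \<longrightarrow> (\<exists>C. \<forall>m. L2_01_norm \<psi> (F m) \<le> C) \<longrightarrow>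
        (\<exists>g\<in>L2 \<psi>. \<exists>r. strict_mono r \<and>
           (\<lambda>m. L2_norm \<psi> (\<lambda>z. canonical_solution \<psi> (F (r m)) z - g z)) \<longlonglongrightarrow> 0))"

definition sum_weight :: "('n::finite \<Rightarrow> complex \<Rightarrow> real) \<Rightarrow> complex^'n \<Rightarrow> real" where
  "sum_weight \<phi> z = (\<Sum>j\<in>UNIV. \<phi> j (z $ j))"

end

theory Submission imports Defs begin

text \<open>Take an orthonormal sequence \<open>f\<^sub>m\<close> in \<open>A\<^sup>2(\<complex>, \<phi>\<^sub>l)\<close> and look at the forms whose only nonzero
coefficient is \<open>f\<^sub>m(z\<^sub>l)\<close>, in front of the conjugate of \<open>dz\<^sub>k\<close>. They have holomorphic coefficients
and, since constants are square integrable in the remaining variables, one common norm. The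
theorem follows because their canonical solutions exist and keep a fixed positive distance from
one another.

Existence. The function \<open>f\<^sub>m(z\<^sub>l) cnj z\<^sub>k\<close> solves the equation. Replacing \<open>cnj\<close> by its component
\<open>w\<close> orthogonal to \<open>A\<^sup>2(\<complex>, \<phi>\<^sub>k)\<close> changes it by an entire function, and \<open>f\<^sub>m(z\<^sub>l) w(z\<^sub>k)\<close> is
orthogonal to \<open>A\<^sup>2(\<complex>\<^sup>n, \<phi>)\<close>: integrate over \<open>z\<^sub>k\<close> first, and use that almost every slice of an element
of \<open>A\<^sup>2(\<complex>\<^sup>n, \<phi>)\<close> lies in \<open>A\<^sup>2(\<complex>, \<phi>\<^sub>k)\<close> (\<open>L2_inner_coords_eq_0\<close>). The component \<open>w\<close>
is \<open>cnj\<close> minus a nearest point of \<open>A\<^sup>2(\<complex>, \<phi>\<^sub>k)\<close> (\<open>A2_1_remainder_exists\<close>). A minimising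
sequence is bounded in norm, hence locally bounded by the mean value property, so Montel's theorem
gives a pointwise limit, and Fatou's lemma shows that the limit is a minimiser.

Separation. The distance between solutions is read off from the equation alone. Let \<open>\<chi>\<close> be a
smooth bump on \<open>\<complex>\<close>. Up to a cutoff in \<open>z\<^sub>l\<close> that is removed at the end, the product of
\<open>cnj (f\<^sub>m(z\<^sub>l)) exp (- 2 \<phi>\<^sub>l(z\<^sub>l))\<close> with \<open>\<chi>(z\<^sub>i)\<close> for all \<open>i \<noteq> l\<close> is a test function, and
differentiating it in the conjugate of \<open>z\<^sub>k\<close> acts only on the factor \<open>\<chi>(z\<^sub>k)\<close>. If \<open>K\<^sub>m\<close> is the
resulting derivative and \<open>u\<^sub>p\<close> is any solution for \<open>f\<^sub>p\<close>, then the integral of \<open>u\<^sub>p K\<^sub>m\<close> is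
\<open>- M\<close> for \<open>p = m\<close> and \<open>0\<close> otherwise, where \<open>M > 0\<close> is independent of \<open>m\<close> and \<open>p\<close>
(\<open>pairing_identity\<close>). The norm of \<open>K\<^sub>m\<close> dual to that of \<open>L\<^sup>2(\<phi>)\<close> does not depend on \<open>m\<close>
either (\<open>L2_sq_pairing_kernel\<close>), so testing the difference of \<open>u\<^sub>p\<close> and \<open>u\<^sub>m\<close> against \<open>K\<^sub>m\<close> bounds
it away from zero.

The test functions above, as well as the mean value property, rest on a smooth function with
compact support and on integration by parts, which come first.\<close>

section \<open>Smooth functions and the flat bump\<close>

text \<open>Since \<^const>\<open>C_k\<close> is defined by recursion through every directional derivative, closure properties
are proved by induction on the order for all functions at once: a product or a composition has
derivatives that are sums of products and compositions of the same kind.\<close>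

lemma C_k_SucI:
  assumes "\<And>x. (f has_derivative D x) (at x)" and "\<And>v. C_k m (\<lambda>x. D x v)"
  shows "C_k (Suc m) f"
proof -
  have "frechet_derivative f (at x) = D x" for x
    using frechet_derivative_at[OF assms(1)] by simp
  then show ?thesis
    using assms by (auto simp: differentiable_def)
qed

lemma C_k_Suc_has_derivative:
  "C_k (Suc m) f \<Longrightarrow> (f has_derivative frechet_derivative f (at x)) (at x)"
  by (simp add: frechet_derivative_works)

lemma C_k_SucD: "C_k (Suc m) f \<Longrightarrow> C_k m f"
proof (induction m arbitrary: f)
  case 0
  then show ?case
    by (auto simp: continuous_on_eq_continuous_within intro!: differentiable_imp_continuous_within)
next
  case (Suc m)
  then show ?case by (metis C_k.simps(2))
qed

lemma C_k_imp_continuous: "C_k m f \<Longrightarrow> continuous_on UNIV f"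
proof (induction m)
  case (Suc m)
  then show ?case using C_k_SucD by blast
qed simp

lemma C_k_const: "C_k m (\<lambda>_. c)"
proof (induction m arbitrary: c)
  case (Suc m)
  show ?case by (rule C_k_SucI[where D = "\<lambda>_ _. 0"]) (auto intro: Suc)
qed auto

lemma C_k_add:
  "C_k m f \<Longrightarrow> C_k m g \<Longrightarrow> C_k m (\<lambda>x. f x + g x)"
proof (induction m arbitrary: f g)
  case 0
  then show ?case by (auto intro: continuous_intros)
next
  case (Suc m)
  show ?case
    by (rule C_k_SucI[OF has_derivative_add[OF C_k_Suc_has_derivative[OF Suc.prems(1)]
          C_k_Suc_has_derivative[OF Suc.prems(2)]]])
       (use Suc in \<open>auto\<close>)
qed

lemma C_k_mult:
  fixes f g :: "'a::euclidean_space \<Rightarrow> 'b::real_normed_algebra"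
  shows "C_k m f \<Longrightarrow> C_k m g \<Longrightarrow> C_k m (\<lambda>x. f x * g x)"
proof (induction m arbitrary: f g)
  case 0
  then show ?case by (auto intro: continuous_intros)
next
  case (Suc m)
  note lower = C_k_SucD[OF Suc.prems(1)] C_k_SucD[OF Suc.prems(2)]
  show ?case
    by (rule C_k_SucI[OF has_derivative_mult[OF C_k_Suc_has_derivative[OF Suc.prems(1)]
          C_k_Suc_has_derivative[OF Suc.prems(2)]]])
       (use Suc lower in \<open>auto intro!: C_k_add\<close>)
qed

lemma C_k_prod:
  fixes f :: "'i \<Rightarrow> 'a::euclidean_space \<Rightarrow> complex"
  assumes "\<And>i. i \<in> I \<Longrightarrow> C_k m (f i)"
  shows "C_k m (\<lambda>x. \<Prod>i\<in>I. f i x)"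
  using assms by (induction I rule: infinite_finite_induct) (auto intro: C_k_const C_k_mult)

lemma C_k_linear_image:
  assumes "bounded_linear L" "C_k m f"
  shows "C_k m (\<lambda>x. L (f x))"
  using assms(2)
proof (induction m arbitrary: f)
  case 0
  then show ?case by (auto intro: bounded_linear.continuous_on[OF assms(1)])
next
  case (Suc m)
  show ?case
    by (rule C_k_SucI[OF bounded_linear.has_derivative[OF assms(1)
          C_k_Suc_has_derivative[OF Suc.prems(1)]]])
       (use Suc in auto)
qed

lemma C_k_affine_comp:
  assumes "bounded_linear L" "C_k m f"
  shows "C_k m (\<lambda>x. f (L x + c))"
  using assms(2)
proof (induction m arbitrary: f)
  case 0
  then show ?case
    by (auto intro!: continuous_on_compose2[of UNIV f] continuous_intros
          bounded_linear.continuous_on[OF assms(1)])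
next
  case (Suc m)
  have "((\<lambda>x. f (L x + c)) has_derivative (\<lambda>v. frechet_derivative f (at (L x + c)) (L v))) (at x)" for x
    by (rule has_derivative_compose[of "\<lambda>x. L x + c" L])
       (use Suc in \<open>auto simp: C_k_Suc_has_derivative[OF Suc.prems(1)]
         intro!: derivative_eq_intros bounded_linear_imp_has_derivative assms(1)\<close>)
  then show ?case
    by (rule C_k_SucI) (use Suc in auto)
qed

lemma C_k_linear: "bounded_linear L \<Longrightarrow> C_k m L"
proof (cases m)
  case (Suc i)
  assume "bounded_linear L"
  then show ?thesis unfolding Suc
    by (intro C_k_SucI[where D = "\<lambda>_. L"])
       (auto intro: bounded_linear_imp_has_derivative C_k_const)
qed (auto intro: linear_continuous_on)

lemma C_k_exp:
  fixes f :: "'a::euclidean_space \<Rightarrow> real"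
  shows "C_k m f \<Longrightarrow> C_k m (\<lambda>x. exp (f x))"
proof (induction m)
  case 0
  then show ?case by (auto intro: continuous_intros)
next
  case (Suc m)
  have "((\<lambda>x. exp (f x)) has_derivative (\<lambda>v. exp (f x) * frechet_derivative f (at x) v)) (at x)" for x
    by (rule derivative_eq_intros C_k_Suc_has_derivative[OF Suc.prems(1)] | simp add: mult.commute)+
  note D = this
  have low: "C_k m (\<lambda>x. exp (f x))"
    using Suc C_k_SucD by blast
  from D show ?case
    by (rule C_k_SucI) (use Suc low in \<open>auto intro!: C_k_mult\<close>)
qed

lemma C_k_holomorphic: "f holomorphic_on UNIV \<Longrightarrow> C_k m f"
proof (induction m arbitrary: f)
  case 0
  then show ?case by (auto intro: holomorphic_on_imp_continuous_on)
next
  case (Suc m)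
  have "(f has_derivative (\<lambda>v. deriv f x * v)) (at x)" for x
    using holomorphic_derivI[OF Suc.prems, of x] by (simp add: has_field_derivative_def)
  note D = this
  have low: "C_k m (deriv f)"
    by (intro Suc.IH holomorphic_deriv[OF Suc.prems]) simp
  from D show ?case
    by (rule C_k_SucI) (intro low C_k_mult C_k_const)
qed

text \<open>For \<open>p = 1\<close> this is the standard smooth function that vanishes to infinite order at \<open>0\<close>. Derivatives
of \<open>exp (- 1/t)\<close> are polynomials in \<open>1/t\<close> times the same exponential, so carrying a polynomial
makes the family closed under differentiation.\<close>

definition flat :: "real poly \<Rightarrow> real \<Rightarrow> real" where
  "flat p t = (if t \<le> 0 then 0 else poly p (1 / t) * exp (- (1 / t)))"

text \<open>The exponential beats every polynomial as \<open>1/t\<close> tends to infinity. Dividing by \<open>t\<close> amounts to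
multiplying \<open>p\<close> by the variable, so this one limit for all \<open>p\<close> also gives differentiability at \<open>0\<close>.\<close>

lemma flat_tendsto_0: "(flat p \<longlongrightarrow> 0) (at 0)"
proof (rule filterlim_split_at)
  show "(flat p \<longlongrightarrow> 0) (at_left 0)"
    by (rule tendsto_eventually) (auto simp: flat_def eventually_at_left_field intro: exI[of _ "-1"])
next
  have "((\<lambda>x::real. \<Sum>i\<le>degree p. coeff p i * (x ^ i / exp x)) \<longlongrightarrow> (\<Sum>i\<le>degree p. coeff p i * 0)) at_top"
    by (intro tendsto_intros tendsto_power_div_exp_0)
  then have "((\<lambda>x. poly p x * exp (- x)) \<longlongrightarrow> 0) at_top"
    by (simp add: poly_altdef sum_divide_distrib exp_minus field_simps)
  then have "((\<lambda>t. poly p (inverse t) * exp (- inverse t)) \<longlongrightarrow> 0) (at_right 0)"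
    by (rule filterlim_compose[OF _ filterlim_inverse_at_top_right])
  then show "(flat p \<longlongrightarrow> 0) (at_right 0)"
    by (rule Lim_transform_eventually)
       (auto simp: flat_def eventually_at_right_field field_simps intro: exI[of _ 1])
qed

text \<open>The polynomial is what the chain rule yields for \<open>p(1/t) exp (- 1/t)\<close>, the inner derivative being
\<open>- 1/t\<^sup>2\<close>.\<close>

lemma flat_has_derivative:
  "(flat p has_real_derivative flat ([:0, 0, 1:] * (p - pderiv p)) t) (at t)"
proof (cases t "0::real" rule: linorder_cases)
  case less
  have "((\<lambda>_. 0) has_real_derivative 0) (at t)" by simp
  then have "(flat p has_real_derivative 0) (at t)"
    by (rule has_field_derivative_transform_within_open[where S = "{..<0}"])
       (use less in \<open>auto simp: flat_def\<close>)
  then show ?thesis using less by (simp add: flat_def)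
next
  case equal
  have "((\<lambda>h. flat p h / h) \<longlongrightarrow> 0) (at 0)"
    by (rule Lim_transform_eventually[OF flat_tendsto_0[of "[:0, 1:] * p"]])
       (auto simp: flat_def eventually_at_filter)
  then show ?thesis
    using equal by (simp add: has_field_derivative_iff flat_def)
next
  case greater
  have "((\<lambda>t. poly p (1 / t) * exp (- (1 / t))) has_real_derivative
        flat ([:0, 0, 1:] * (p - pderiv p)) t) (at t)"
    using greater
    by (auto intro!: derivative_eq_intros DERIV_chain2[OF poly_DERIV]
         simp: flat_def field_simps power2_eq_square)
  then show ?thesis
    by (rule has_field_derivative_transform_within_open[where S = "{0<..}"])
       (use greater in \<open>auto simp: flat_def\<close>)
qed

lemma C_k_flat_comp:
  fixes q :: "'a::euclidean_space \<Rightarrow> real"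
  shows "C_k m q \<Longrightarrow> C_k m (\<lambda>x. flat p (q x))"
proof (induction m arbitrary: p)
  case 0
  have "isCont (flat p) t" for t by (rule DERIV_isCont[OF flat_has_derivative])
  then have "continuous_on UNIV (flat p)" by (simp add: continuous_at_imp_continuous_on)
  with 0 show ?case by (auto intro: continuous_on_compose2)
next
  case (Suc m)
  have "((\<lambda>x. flat p (q x)) has_derivative
         (\<lambda>v. flat ([:0, 0, 1:] * (p - pderiv p)) (q x) * frechet_derivative q (at x) v)) (at x)" for x
    using has_derivative_compose[OF C_k_Suc_has_derivative[OF Suc.prems],
        OF flat_has_derivative[unfolded has_field_derivative_def]] by simp
  note D = this
  have low: "C_k m (\<lambda>x. flat ([:0, 0, 1:] * (p - pderiv p)) (q x))"
    by (intro Suc.IH C_k_SucD[OF Suc.prems])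
  from D show ?case
    by (rule C_k_SucI) (use Suc low in \<open>auto intro!: C_k_mult\<close>)
qed

text \<open>A radial function that is supported in the closed unit disc. The polynomial is kept as a
parameter because the conjugate derivative of one bump is, up to the factor \<open>- z\<close>, another one.\<close>

definition bump :: "real poly \<Rightarrow> complex \<Rightarrow> complex" where
  "bump p z = of_real (flat p (1 - (cmod z)\<^sup>2))"

lemma C_k_one_minus_norm: "C_k m (\<lambda>z::complex. 1 - (cmod z)\<^sup>2)"
proof -
  have "(\<lambda>z. 1 - (cmod z)\<^sup>2) = (\<lambda>z. 1 + (-1) * (Re z * Re z + Im z * Im z))"
    by (rule ext) (simp add: cmod_power2, simp add: power2_eq_square)
  moreover have "C_k m (\<lambda>z. 1 + (-1) * (Re z * Re z + Im z * Im z))"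
    by (intro C_k_add C_k_mult C_k_const C_k_linear bounded_linear_Re bounded_linear_Im)
  ultimately show ?thesis by (simp only:)
qed

lemma C_k_bump: "C_k m (bump p)"
  unfolding bump_def
  by (intro C_k_linear_image[OF bounded_linear_of_real] C_k_flat_comp C_k_one_minus_norm)

lemma bump_eq_0: "1 \<le> cmod z \<Longrightarrow> bump p z = 0"
  by (simp add: bump_def flat_def)

section \<open>Integration by parts against compactly supported functions\<close>

lemma integrable_compact_support:
  fixes f :: "'a::euclidean_space \<Rightarrow> 'b::{banach, second_countable_topology}"
  assumes "continuous_on UNIV f" "compact K" "\<And>x. x \<notin> K \<Longrightarrow> f x = 0"
  shows "integrable lborel f"
proof -
  have "integrable lborel (\<lambda>x. indicator K x *\<^sub>R f x)"
    using assms by (intro borel_integrable_compact) (auto intro: continuous_on_subset)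
  also have "(\<lambda>x. indicator K x *\<^sub>R f x) = f"
    using assms(3) by (auto simp: fun_eq_iff indicator_def)
  finally show ?thesis .
qed

lemma frechet_derivative_eq_0_outside_support:
  assumes "x \<notin> closure {z. g z \<noteq> 0}"
  shows "frechet_derivative g (at x) v = 0"
proof -
  have "(g has_derivative (\<lambda>_. 0)) (at x)"
    by (rule has_derivative_transform_within_open[OF has_derivative_const[of 0],
          where s = "- closure {z. g z \<noteq> 0}"])
       (use assms closure_subset[of "{z. g z \<noteq> 0}"] in auto)
  from frechet_derivative_at[OF this, symmetric] show ?thesis by simp
qed

text \<open>The mean value inequality along one direction, where only the derivative in that direction
enters; it dominates the difference quotients below.\<close>

lemma norm_increment_le_directional_derivative:
  fixes g :: "'a::euclidean_space \<Rightarrow> 'b::real_normed_vector"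
  assumes g: "C_k (Suc 0) g" and M: "\<And>x. norm (frechet_derivative g (at x) v) \<le> M"
  shows "norm (g (x + t *\<^sub>R v) - g x) \<le> M * \<bar>t\<bar>"
proof -
  have der: "((\<lambda>s. g (x + s *\<^sub>R v)) has_derivative
       (\<lambda>h. h *\<^sub>R frechet_derivative g (at (x + s *\<^sub>R v)) v)) (at s within UNIV)" for s
  proof -
    have "((\<lambda>s. x + s *\<^sub>R v) has_derivative (\<lambda>h. h *\<^sub>R v)) (at s)"
      by (auto intro!: derivative_eq_intros)
    from has_derivative_compose[OF this C_k_Suc_has_derivative[OF g]]
    show ?thesis
      using has_derivative_linear[OF C_k_Suc_has_derivative[OF g]]
      by (simp add: linear_cmul)
  qed
  have "norm (g (x + t *\<^sub>R v) - g (x + 0 *\<^sub>R v)) \<le> M * norm (t - 0)"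
  proof (rule differentiable_bound[OF _ der])
    show "onorm (\<lambda>h. h *\<^sub>R frechet_derivative g (at (x + s *\<^sub>R v)) v) \<le> M" for s
      by (rule onorm_le) (use M in \<open>auto simp: mult.commute[of M] intro!: mult_left_mono\<close>)
  qed auto
  then show ?thesis by simp
qed

lemma lborel_integral_translate:
  fixes g :: "'a::euclidean_space \<Rightarrow> 'b::{banach, second_countable_topology}"
  assumes "g \<in> borel_measurable borel"
  shows "(\<integral>x. g (x + c) \<partial>lborel) = (\<integral>x. g x \<partial>lborel)"
    and "integrable lborel (\<lambda>x. g (x + c)) \<longleftrightarrow> integrable lborel g"
proof -
  have "(\<integral>x. g x \<partial>distr lborel borel ((+) c)) = (\<integral>x. g (c + x) \<partial>lborel)"
    using assms by (intro integral_distr) auto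
  then show "(\<integral>x. g (x + c) \<partial>lborel) = (\<integral>x. g x \<partial>lborel)"
    by (simp add: lborel_distr_plus add.commute)
  have "integrable (distr lborel borel ((+) c)) g \<longleftrightarrow> integrable lborel (\<lambda>x. g (c + x))"
    using assms by (intro integrable_distr_eq) auto
  then show "integrable lborel (\<lambda>x. g (x + c)) \<longleftrightarrow> integrable lborel g"
    by (simp add: lborel_distr_plus add.commute)
qed

text \<open>By translation invariance of Lebesgue measure, every difference quotient of \<open>g\<close> in the direction \<open>v\<close>
has integral zero. The quotients converge to the derivative and are bounded by a constant on
a fixed ball outside which they vanish, so the integral passes to the limit.\<close>

lemma integral_directional_derivative_eq_0:
  fixes g :: "'a::euclidean_space \<Rightarrow> complex"
  assumes g: "C_k (Suc 0) g" and supp: "compact (closure {z. g z \<noteq> 0})"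
  shows "(\<integral>x. frechet_derivative g (at x) v \<partial>lborel) = 0"
proof -
  define K where "K = closure {z. g z \<noteq> 0}"
  define Dg where "Dg = (\<lambda>x. frechet_derivative g (at x) v)"
  define h :: "nat \<Rightarrow> real" where "h n = 1 / real (Suc n)" for n
  define q where "q n x = (g (x + h n *\<^sub>R v) - g x) /\<^sub>R h n" for n x
  have h: "0 < h n" "h n \<le> 1" for n by (auto simp: h_def)
  have K: "compact K" "x \<notin> K \<Longrightarrow> g x = 0" for x
    using supp closure_subset[of "{z. g z \<noteq> 0}"] by (auto simp: K_def)
  have cont: "continuous_on UNIV g" "continuous_on UNIV Dg"
    using g C_k_imp_continuous[OF g] by (auto simp: Dg_def)
  have int: "integrable lborel g"
    by (rule integrable_compact_support[OF cont(1) K(1)]) (auto intro: K(2))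
  have [measurable]: "g \<in> borel_measurable borel" "Dg \<in> borel_measurable borel"
    using cont by (auto intro: borel_measurable_continuous_onI)
  obtain R where R: "\<And>x. x \<in> K \<Longrightarrow> norm x \<le> R"
    using compact_imp_bounded[OF K(1)] by (auto simp: bounded_iff)
  have "bounded (Dg ` K)"
    by (intro compact_imp_bounded compact_continuous_image K continuous_on_subset[OF cont(2)]) auto
  then obtain M0 where "\<And>x. x \<in> K \<Longrightarrow> norm (Dg x) \<le> M0"
    by (auto simp: bounded_iff)
  then have M: "norm (Dg x) \<le> max M0 0" for x
    using frechet_derivative_eq_0_outside_support[of x g v]
    by (cases "x \<in> K") (auto simp: K_def[symmetric] Dg_def le_max_iff_disj)
  have "(\<integral>x. q n x \<partial>lborel) = 0" for n
  proof -
    have "(\<integral>x. q n x \<partial>lborel) = ((\<integral>x. g (x + h n *\<^sub>R v) \<partial>lborel) - (\<integral>x. g x \<partial>lborel)) /\<^sub>R h n"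
      unfolding q_def using int by (simp add: lborel_integral_translate(2))
    then show ?thesis by (simp add: lborel_integral_translate(1))
  qed
  moreover have "(\<lambda>n. \<integral>x. q n x \<partial>lborel) \<longlonglongrightarrow> (\<integral>x. Dg x \<partial>lborel)"
  proof (rule integral_dominated_convergence)
    \<comment> \<open>The steps \<open>h n\<close> are at most \<open>1\<close>, so translation moves the support by at most \<open>norm v\<close>.\<close>
    show "integrable lborel (\<lambda>x. indicator (cball 0 (R + norm v)) x *\<^sub>R max M0 0)"
      by (intro borel_integrable_compact) auto
    show "AE x in lborel. norm (q n x) \<le> indicator (cball 0 (R + norm v)) x *\<^sub>R max M0 0" for n
    proof (rule AE_I2)
      fix x
      show "norm (q n x) \<le> indicator (cball 0 (R + norm v)) x *\<^sub>R max M0 0"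
      proof (cases "norm x \<le> R + norm v")
        case True
        have "norm (g (x + h n *\<^sub>R v) - g x) \<le> max M0 0 * \<bar>h n\<bar>"
          by (rule norm_increment_le_directional_derivative[OF g]) (use M in \<open>simp add: Dg_def\<close>)
        then have "norm (g (x + h n *\<^sub>R v) - g x) / h n \<le> max M0 0"
          using h[of n] by (simp add: pos_divide_le_eq)
        moreover have "norm (q n x) = norm (g (x + h n *\<^sub>R v) - g x) / h n"
          using h[of n] by (simp only: q_def norm_scaleR) (simp add: divide_inverse)
        ultimately show ?thesis
          using True by simp
      next
        case False
        have "norm x \<le> norm (x + h n *\<^sub>R v) + norm (h n *\<^sub>R v)"
          using norm_triangle_ineq4[of "x + h n *\<^sub>R v" "h n *\<^sub>R v"] by simp
        also have "norm (h n *\<^sub>R v) \<le> norm v"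
          using h[of n] mult_right_mono[of "h n" 1 "norm v"] by simp
        finally have "\<not> norm (x + h n *\<^sub>R v) \<le> R" using False by linarith
        then have "g (x + h n *\<^sub>R v) = 0" using R K(2) by blast
        moreover have "\<not> norm x \<le> R" using False norm_ge_zero[of v] by linarith
        then have "g x = 0" using R K(2) by blast
        ultimately show ?thesis by (simp add: q_def)
      qed
    qed
    show "AE x in lborel. (\<lambda>n. q n x) \<longlonglongrightarrow> Dg x"
    proof (rule AE_I2)
      fix x
      have 1: "((\<lambda>t. x + t *\<^sub>R v) has_derivative (\<lambda>t. t *\<^sub>R v)) (at 0)"
        by (auto intro!: derivative_eq_intros)
      have "(g has_derivative frechet_derivative g (at x)) (at (x + 0 *\<^sub>R v))"
        using C_k_Suc_has_derivative[OF g] by simp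
      from has_derivative_compose[OF 1 this]
      have "((\<lambda>t. g (x + t *\<^sub>R v)) has_derivative (\<lambda>t. frechet_derivative g (at x) (t *\<^sub>R v))) (at 0)"
        .
      then have "((\<lambda>t. (g (x + t *\<^sub>R v) - g x - t *\<^sub>R Dg x) /\<^sub>R norm t) \<longlongrightarrow> 0) (at 0)"
        using linear_cmul[OF has_derivative_linear[OF C_k_Suc_has_derivative[OF g]]]
        unfolding has_derivative_def Dg_def by (simp add: netlimit_at)
      moreover have "filterlim h (at 0) sequentially"
        unfolding filterlim_at h_def using LIMSEQ_inverse_real_of_nat
        by (simp add: inverse_eq_divide)
      ultimately have lim: "(\<lambda>n. (g (x + h n *\<^sub>R v) - g x - h n *\<^sub>R Dg x) /\<^sub>R norm (h n)) \<longlonglongrightarrow> 0"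
        by (rule filterlim_compose)
      have "(g (x + h n *\<^sub>R v) - g x - h n *\<^sub>R Dg x) /\<^sub>R norm (h n) = q n x - Dg x" for n
      proof -
        have "inverse (h n) *\<^sub>R h n *\<^sub>R Dg x = Dg x" using h(1)[of n] by simp
        then show ?thesis using h(1)[of n] by (simp only: q_def scaleR_diff_right real_norm_def abs_of_pos)
      qed
      with lim have "(\<lambda>n. q n x - Dg x) \<longlonglongrightarrow> 0" by simp
      then show "(\<lambda>n. q n x) \<longlonglongrightarrow> Dg x" by (rule LIM_zero_cancel)
    qed
  qed (auto simp: q_def)
  ultimately show ?thesis
    by (simp add: Dg_def LIMSEQ_const_iff)
qed

lemma frechet_derivative_mult_C_k:
  fixes f g :: "'a::euclidean_space \<Rightarrow> complex"
  assumes "C_k (Suc 0) f" "C_k (Suc 0) g"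
  shows "frechet_derivative (\<lambda>x. f x * g x) (at x) v =
     f x * frechet_derivative g (at x) v + frechet_derivative f (at x) v * g x"
  by (subst frechet_derivative_at[OF has_derivative_mult[OF
        C_k_Suc_has_derivative[OF assms(1)] C_k_Suc_has_derivative[OF assms(2)]], symmetric]) simp

lemma integral_by_parts_directional:
  fixes u \<eta> :: "'a::euclidean_space \<Rightarrow> complex"
  assumes u: "C_k (Suc 0) u" and \<eta>: "C_k (Suc 0) \<eta>" and supp: "compact (closure {z. \<eta> z \<noteq> 0})"
  shows "(\<integral>x. u x * frechet_derivative \<eta> (at x) v \<partial>lborel) =
         - (\<integral>x. frechet_derivative u (at x) v * \<eta> x \<partial>lborel)" (is "?A = - ?B")
    and "integrable lborel (\<lambda>x. u x * frechet_derivative \<eta> (at x) v)"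
    and "integrable lborel (\<lambda>x. frechet_derivative u (at x) v * \<eta> x)"
proof -
  have cont: "continuous_on UNIV u" "continuous_on UNIV \<eta>"
     "continuous_on UNIV (\<lambda>x. frechet_derivative u (at x) v)"
     "continuous_on UNIV (\<lambda>x. frechet_derivative \<eta> (at x) v)"
    using u \<eta> C_k_imp_continuous[OF u] C_k_imp_continuous[OF \<eta>] by auto
  have \<eta>0: "x \<notin> closure {z. \<eta> z \<noteq> 0} \<Longrightarrow> \<eta> x = 0" for x
    using closure_subset[of "{z. \<eta> z \<noteq> 0}"] by auto
  show i1: "integrable lborel (\<lambda>x. u x * frechet_derivative \<eta> (at x) v)"
    by (rule integrable_compact_support[OF continuous_on_mult[OF cont(1,4)] supp])
       (simp add: frechet_derivative_eq_0_outside_support)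
  show i2: "integrable lborel (\<lambda>x. frechet_derivative u (at x) v * \<eta> x)"
    by (rule integrable_compact_support[OF continuous_on_mult[OF cont(3,2)] supp])
       (drule \<eta>0, simp)
  have "{z. u z * \<eta> z \<noteq> 0} \<subseteq> {z. \<eta> z \<noteq> 0}" by auto
  then have "compact (closure {z. u z * \<eta> z \<noteq> 0})"
    using supp by (metis bounded_subset compact_closure)
  then have "(\<integral>x. frechet_derivative (\<lambda>x. u x * \<eta> x) (at x) v \<partial>lborel) = 0"
    by (intro integral_directional_derivative_eq_0 C_k_mult u \<eta>)
  then have "?A + ?B = 0"
    using i1 i2 by (simp add: frechet_derivative_mult_C_k[OF u \<eta>])
  then show "?A = - ?B" by (simp add: add_eq_0_iff2)
qed

section \<open>The mean value property with a smooth kernel\<close>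

text \<open>Stated for an arbitrary pair of directions, so that it covers the conjugate derivative in one
variable as well as each of those in several variables.\<close>

lemma integral_by_parts_wirtinger:
  fixes u \<eta> :: "'a::euclidean_space \<Rightarrow> complex"
  assumes u: "C_k (Suc 0) u" and \<eta>: "C_k (Suc 0) \<eta>" and supp: "compact (closure {z. \<eta> z \<noteq> 0})"
  shows "(\<integral>x. u x * ((frechet_derivative \<eta> (at x) v + \<i> * frechet_derivative \<eta> (at x) w) / 2) \<partial>lborel) =
         - (\<integral>x. (frechet_derivative u (at x) v + \<i> * frechet_derivative u (at x) w) / 2 * \<eta> x \<partial>lborel)"
proof -
  note v = integral_by_parts_directional[OF u \<eta> supp, of v] and w = integral_by_parts_directional[OF u \<eta> supp, of w]
  have "(\<integral>x. u x * ((frechet_derivative \<eta> (at x) v + \<i> * frechet_derivative \<eta> (at x) w) / 2) \<partial>lborel) =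
      (\<integral>x. 1 / 2 * (u x * frechet_derivative \<eta> (at x) v)
          + \<i> / 2 * (u x * frechet_derivative \<eta> (at x) w) \<partial>lborel)"
    by (intro Bochner_Integration.integral_cong) (auto simp: field_simps)
  also have "\<dots> = - (\<integral>x. 1 / 2 * (frechet_derivative u (at x) v * \<eta> x)
          + \<i> / 2 * (frechet_derivative u (at x) w * \<eta> x) \<partial>lborel)"
    using v w by (simp add: Bochner_Integration.integral_add)
  also have "(\<integral>x. 1 / 2 * (frechet_derivative u (at x) v * \<eta> x)
          + \<i> / 2 * (frechet_derivative u (at x) w * \<eta> x) \<partial>lborel) =
     (\<integral>x. (frechet_derivative u (at x) v + \<i> * frechet_derivative u (at x) w) / 2 * \<eta> x \<partial>lborel)"
    by (intro Bochner_Integration.integral_cong) (auto simp: field_simps)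
  finally show ?thesis .
qed

text \<open>The counterpart in one variable of \<^const>\<open>dzbar\<close>.\<close>

definition dzbar_1 :: "(complex \<Rightarrow> complex) \<Rightarrow> complex \<Rightarrow> complex" where
  "dzbar_1 f z = (frechet_derivative f (at z) 1 + \<i> * frechet_derivative f (at z) \<i>) / 2"

lemma frechet_derivative_holomorphic:
  assumes "f holomorphic_on UNIV"
  shows "frechet_derivative f (at z) v = deriv f z * v"
proof -
  have "(f has_derivative (*) (deriv f z)) (at z)"
    using holomorphic_derivI[OF assms, of z] by (simp add: has_field_derivative_def)
  from frechet_derivative_at[OF this, symmetric] show ?thesis by simp
qed

lemma dzbar_1_holomorphic: "f holomorphic_on UNIV \<Longrightarrow> dzbar_1 f z = 0"
  by (simp add: dzbar_1_def frechet_derivative_holomorphic field_simps)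

text \<open>A bump is a function of \<open>1 - z cnj z\<close>, whose conjugate derivative is \<open>- z\<close>. Hence \<open>z\<close> times
a bump with coefficient polynomial \<open>x\<^sup>2\<close> is an exact conjugate derivative of a compactly supported
function, which is what makes the mean value property below work.\<close>

lemma dzbar_1_bump: "dzbar_1 (bump p) z = - z * bump ([:0, 0, 1:] * (p - pderiv p)) z"
proof -
  define p' where "p' = [:0, 0, 1:] * (p - pderiv p)"
  have "((\<lambda>z. 1 - (z \<bullet> z)) has_derivative (\<lambda>v. - 2 * (z \<bullet> v))) (at z)"
    by (auto intro!: derivative_eq_intros simp: inner_commute)
  then have "((\<lambda>z. flat p (1 - (z \<bullet> z))) has_derivative
      (\<lambda>v. flat p' (1 - (z \<bullet> z)) * (- 2 * (z \<bullet> v)))) (at z)"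
    unfolding p'_def
    by (rule has_derivative_compose[OF _ flat_has_derivative[unfolded has_field_derivative_def]])
  from has_derivative_of_real[OF this]
  have "(bump p has_derivative (\<lambda>v. bump p' z * of_real (- 2 * (z \<bullet> v)))) (at z)"
    by (simp add: bump_def[abs_def] power2_norm_eq_inner)
  from frechet_derivative_at[OF this, symmetric]
  have D: "frechet_derivative (bump p) (at z) v = bump p' z * of_real (- 2 * (z \<bullet> v))" for v
    by simp
  have "dzbar_1 (bump p) z = - bump p' z * (of_real (Re z) + \<i> * of_real (Im z))"
    unfolding dzbar_1_def D by (simp add: inner_complex_def field_simps)
  also have "of_real (Re z) + \<i> * of_real (Im z) = z"
    by (simp add: complex_eq_iff)
  finally show ?thesis
    unfolding p'_def[symmetric] by (simp add: mult.commute)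
qed

lemma compact_support_bump: "compact (closure {z. bump p z \<noteq> 0})"
proof -
  have "{z. bump p z \<noteq> 0} \<subseteq> cball 0 1"
    using bump_eq_0[of _ p] by (metis (mono_tags, lifting) linorder_linear mem_Collect_eq mem_cball_0 subsetI)
  then show ?thesis
    using bounded_subset by (auto simp: compact_closure)
qed

lemma integrable_bump: "integrable lborel (bump p)"
  by (rule integrable_compact_support[OF C_k_imp_continuous[OF C_k_bump] compact_cball[of 0 1]])
     (auto intro: bump_eq_0)

lemma continuous_AE_eq_0:
  fixes f :: "'a::euclidean_space \<Rightarrow> 'b::real_normed_vector"
  assumes "continuous_on UNIV f" "AE x in lborel. f x = 0"
  shows "f x = 0"
proof (rule ccontr)
  assume "f x \<noteq> 0"
  have "open (f -` (- {0}))"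
    using assms(1) by (intro open_vimage) auto
  then have "\<not> negligible (f -` (- {0}))"
    using \<open>f x \<noteq> 0\<close> by (intro open_not_negligible) auto
  moreover have "AE x in lebesgue. x \<notin> f -` (- {0})"
    using AE_completion[OF assms(2)] by auto
  then have "negligible (f -` (- {0}))"
    using \<open>open _\<close> AE_iff_null_sets[of "f -` (- {0})" lebesgue]
    by (simp add: negligible_iff_null_sets borel_open sets_completionI_sets)
  ultimately show False by blast
qed

lemma integral_continuous_pos:
  fixes f :: "'a::euclidean_space \<Rightarrow> real"
  assumes "continuous_on UNIV f" "\<And>x. 0 \<le> f x" "integrable lborel f" "f x \<noteq> 0"
  shows "0 < (\<integral>x. f x \<partial>lborel)"
proof -
  have "(\<integral>x. f x \<partial>lborel) \<noteq> 0"
  proof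
    assume "(\<integral>x. f x \<partial>lborel) = 0"
    then have "AE x in lborel. f x = 0"
      by (subst (asm) integral_nonneg_eq_0_iff_AE[OF assms(3)]) (use assms(2) in auto)
    from continuous_AE_eq_0[OF assms(1) this] assms(4) show False by simp
  qed
  moreover have "0 \<le> (\<integral>x. f x \<partial>lborel)" using assms(2) by simp
  ultimately show ?thesis by simp
qed

definition bump_mass :: "real poly \<Rightarrow> real" where
  "bump_mass p = (\<integral>z. flat p (1 - (cmod z)\<^sup>2) \<partial>lborel)"

lemma integral_bump: "(\<integral>z. bump p z \<partial>lborel) = of_real (bump_mass p)"
  unfolding bump_def bump_mass_def by (rule integral_complex_of_real)

lemma bump_mass_pos:
  assumes "\<And>x. 0 \<le> poly p x" "poly p 1 \<noteq> 0"
  shows "0 < bump_mass p"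
  unfolding bump_mass_def
proof (rule integral_continuous_pos[of _ 0])
  show "continuous_on UNIV (\<lambda>z::complex. flat p (1 - (cmod z)\<^sup>2))"
    by (rule C_k_imp_continuous[OF C_k_flat_comp[OF C_k_one_minus_norm, of 0]])
  then show "integrable lborel (\<lambda>z::complex. flat p (1 - (cmod z)\<^sup>2))"
    by (rule integrable_compact_support[OF _ compact_cball[of 0 1]])
       (auto simp: flat_def abs_square_le_1)
qed (use assms in \<open>auto simp: flat_def\<close>)

text \<open>Write \<open>h(z) = h(p) + (z - p) h\<^sub>1(z)\<close> with \<open>h\<^sub>1\<close> entire. The kernel times \<open>z - p\<close> is the conjugate
derivative of a compactly supported function, so the second term integrates to zero against the
kernel by parts, because the conjugate derivative of \<open>h\<^sub>1\<close> vanishes.\<close>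

lemma holomorphic_mean_value:
  assumes h: "h holomorphic_on UNIV"
  shows "h p * of_real (bump_mass [:0, 0, 1:]) = (\<integral>z. h z * bump [:0, 0, 1:] (z - p) \<partial>lborel)"
proof -
  let ?\<rho> = "bump [:0, 0, 1:]"
  define h1 where "h1 z = (if z = p then deriv h p else (h z - h p) / (z - p))" for z
  have h1: "h1 holomorphic_on UNIV"
    unfolding h1_def using pole_lemma_open[OF h, of p] by simp
  have hol: "(\<lambda>z. h1 (z + p)) holomorphic_on UNIV"
    by (intro holomorphic_on_compose_gen[of "\<lambda>z. z + p" UNIV h1 UNIV, unfolded o_def])
       (auto intro!: holomorphic_intros h1)
  have h_eq: "h (z + p) = h p + z * h1 (z + p)" for z
    by (simp add: h1_def)
  have "(\<integral>z. h1 (z + p) * dzbar_1 (bump 1) z \<partial>lborel) = - (\<integral>z. dzbar_1 (\<lambda>z. h1 (z + p)) z * bump 1 z \<partial>lborel)"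
    unfolding dzbar_1_def
    by (intro integral_by_parts_wirtinger C_k_holomorphic hol C_k_bump compact_support_bump)
  then have "(\<integral>z. h1 (z + p) * (- z * ?\<rho> z) \<partial>lborel) = 0"
    by (simp add: dzbar_1_bump dzbar_1_holomorphic[OF hol])
  then have 0: "(\<integral>z. z * h1 (z + p) * ?\<rho> z \<partial>lborel) = 0"
    by (simp add: mult.assoc mult.left_commute[of "h1 _"])
  have cont: "continuous_on UNIV h" "continuous_on UNIV (\<lambda>z. h1 (z + p))" "continuous_on UNIV ?\<rho>"
    using h hol C_k_imp_continuous[OF C_k_bump] by (auto intro: holomorphic_on_imp_continuous_on)
  have int: "integrable lborel (\<lambda>z. z * h1 (z + p) * ?\<rho> z)"
    by (rule integrable_compact_support[OF _ compact_cball[of 0 1]])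
       (auto intro!: continuous_on_mult cont simp: bump_eq_0)
  have [measurable]: "h \<in> borel_measurable borel" "?\<rho> \<in> borel_measurable borel"
    using cont by (auto intro: borel_measurable_continuous_onI)
  have "(\<integral>z. h z * ?\<rho> (z - p) \<partial>lborel) = (\<integral>z. h (z + p) * ?\<rho> z \<partial>lborel)"
    by (subst lborel_integral_translate(1)[symmetric, where c = p]) auto
  also have "\<dots> = (\<integral>z. h p * ?\<rho> z + z * h1 (z + p) * ?\<rho> z \<partial>lborel)"
    by (simp add: h_eq algebra_simps)
  also have "\<dots> = h p * (\<integral>z. ?\<rho> z \<partial>lborel) + 0"
    using int integrable_bump by (simp add: 0)
  finally show ?thesis by (simp add: integral_bump)
qed

lemma mult_le_sum_squares: "0 \<le> a \<Longrightarrow> 0 \<le> b \<Longrightarrow> a * b \<le> a\<^sup>2 + b\<^sup>2" for a b :: real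
proof -
  assume "0 \<le> a" "0 \<le> b"
  then have "0 \<le> a * b" by (rule mult_nonneg_nonneg)
  moreover have "2 * (a * b) \<le> a\<^sup>2 + b\<^sup>2"
    using sum_squares_bound[of a b] by (simp only: mult.assoc)
  ultimately show ?thesis by linarith
qed

lemma power_mult_exp: "(a * exp x)\<^sup>2 = a\<^sup>2 * exp (2 * x)" for a x :: real
  by (simp only: power_mult_distrib exp_double)

text \<open>Bound the kernel average in the mean value property by \<open>|h| |\<rho>| \<le> |h|\<^sup>2 e\<^sup>-\<^sup>2\<^sup>\<psi> + |\<rho>|\<^sup>2 e\<^sup>2\<^sup>\<psi>\<close>. For
centres in a compact set, the second summand is bounded and lives on a fixed disc.\<close>

lemma A2_1_locally_bounded:
  assumes \<psi>: "continuous_on UNIV \<psi>" and K: "compact K"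
  obtains C where "\<And>h p. h \<in> A2_1 \<psi> \<Longrightarrow> p \<in> K \<Longrightarrow>
    cmod (h p) \<le> C * ((\<integral>z. (cmod (h z))\<^sup>2 * exp (- 2 * \<psi> z) \<partial>lborel) + 1)"
proof -
  let ?\<rho> = "bump [:0, 0, 1:]"
  define c where "c = bump_mass [:0, 0, 1:]"
  have c: "0 < c" unfolding c_def by (rule bump_mass_pos) auto
  obtain R where R: "\<And>p. p \<in> K \<Longrightarrow> cmod p \<le> R"
    using compact_imp_bounded[OF K] by (auto simp: bounded_iff)
  define Q where "Q = cball (0::complex) (R + 1)"
  have cont: "continuous_on UNIV ?\<rho>" by (rule C_k_imp_continuous[OF C_k_bump])
  have "bounded (?\<rho> ` cball 0 1)" "bounded ((\<lambda>z. exp (2 * \<psi> z)) ` Q)"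
    unfolding Q_def
    by (intro compact_imp_bounded compact_continuous_image continuous_on_subset[OF cont]
          continuous_intros continuous_on_subset[OF \<psi>]; simp)+
  then obtain M1 M2' where M1: "\<forall>w \<in> ?\<rho> ` cball 0 1. cmod w \<le> M1"
      and M2': "\<forall>w \<in> (\<lambda>z. exp (2 * \<psi> z)) ` Q. norm w \<le> M2'"
    by (auto simp only: bounded_iff)
  define M2 where "M2 = max M2' 0"
  have M: "cmod z \<le> 1 \<Longrightarrow> cmod (?\<rho> z) \<le> M1" "z \<in> Q \<Longrightarrow> exp (2 * \<psi> z) \<le> M2" "0 \<le> M2" for z
    using M1 M2' by (auto simp: M2_def le_max_iff_disj)
  define E where "E = M1\<^sup>2 * M2 * (\<integral>z. indicator Q z \<partial>lborel)"
  have "0 \<le> E" using M(3) by (simp add: E_def)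
  have "cmod (h p) \<le> (1 + E) / c * ((\<integral>z. (cmod (h z))\<^sup>2 * exp (- 2 * \<psi> z) \<partial>lborel) + 1)"
    if h: "h \<in> A2_1 \<psi>" and p: "p \<in> K" for h p
  proof -
    have hol: "h holomorphic_on UNIV" using h by (simp add: A2_1_def)
    have [measurable]: "h \<in> borel_measurable borel" "\<psi> \<in> borel_measurable borel" "?\<rho> \<in> borel_measurable borel"
      using hol \<psi> cont by (auto intro: borel_measurable_continuous_onI holomorphic_on_imp_continuous_on)
    let ?N = "\<lambda>z. (cmod (h z))\<^sup>2 * exp (- 2 * \<psi> z)"
    have int: "integrable lborel ?N"
      using h by (simp add: A2_1_def L2_def integrable_completion)
    have intQ: "integrable lborel (indicator Q :: complex \<Rightarrow> real)"
      unfolding Q_def using borel_integrable_compact[of "cball 0 (R + 1)" "\<lambda>_. 1::real"] by simp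
    have pointwise: "cmod (h z * ?\<rho> (z - p)) \<le> ?N z + M1\<^sup>2 * M2 * indicator Q z" for z
    proof (cases "cmod (z - p) \<le> 1")
      case True
      have "cmod z \<le> R + 1"
        using R[OF p] True norm_triangle_sub[of z p] by linarith
      then have zQ: "z \<in> Q" by (simp add: Q_def)
      have "cmod (h z * ?\<rho> (z - p)) =
          (cmod (h z) * exp (- \<psi> z)) * (cmod (?\<rho> (z - p)) * exp (\<psi> z))"
        by (simp add: norm_mult exp_minus)
      also have "\<dots> \<le> (cmod (h z) * exp (- \<psi> z))\<^sup>2 + (cmod (?\<rho> (z - p)) * exp (\<psi> z))\<^sup>2"
        by (rule mult_le_sum_squares) simp_all
      also have "(cmod (h z) * exp (- \<psi> z))\<^sup>2 = ?N z"
        by (simp add: power_mult_exp)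
      also have "(cmod (?\<rho> (z - p)) * exp (\<psi> z))\<^sup>2 = (cmod (?\<rho> (z - p)))\<^sup>2 * exp (2 * \<psi> z)"
        by (simp add: power_mult_exp)
      also have "\<dots> \<le> M1\<^sup>2 * M2"
        using M(1)[of "z - p"] M(2)[OF zQ] True by (intro mult_mono power_mono) auto
      finally show ?thesis using zQ by simp
    next
      case False
      have "0 \<le> M1\<^sup>2 * M2 * indicator Q z"
        using M(3) by simp
      moreover have "?\<rho> (z - p) = 0" using False by (intro bump_eq_0) simp
      ultimately show ?thesis by simp
    qed
    have "cmod (h p) * c = cmod (\<integral>z. h z * ?\<rho> (z - p) \<partial>lborel)"
      using c unfolding c_def by (subst holomorphic_mean_value[OF hol, symmetric]) (simp add: norm_mult)
    also have "\<dots> \<le> (\<integral>z. ?N z + M1\<^sup>2 * M2 * indicator Q z \<partial>lborel)"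
      proof (rule Bochner_Integration.integral_norm_bound_integral)
      show dom: "integrable lborel (\<lambda>z. ?N z + M1\<^sup>2 * M2 * indicator Q z)"
        using int intQ by simp
      show "integrable lborel (\<lambda>z. h z * ?\<rho> (z - p))"
      proof (rule Bochner_Integration.integrable_bound[OF dom])
        show "AE z in lborel. norm (h z * ?\<rho> (z - p)) \<le> norm (?N z + M1\<^sup>2 * M2 * indicator Q z)"
          unfolding real_norm_def by (intro AE_I2 order_trans[OF pointwise] abs_ge_self)
      qed measurable
    qed (rule pointwise)
    also have "\<dots> = (\<integral>z. ?N z \<partial>lborel) + E"
      using int intQ by (simp add: E_def)
    also have "\<dots> \<le> (1 + E) * ((\<integral>z. ?N z \<partial>lborel) + 1)"
    proof -
      have "0 \<le> (\<integral>z. ?N z \<partial>lborel)" by simp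
      then show ?thesis using \<open>0 \<le> E\<close> by (simp add: algebra_simps)
    qed
    finally show ?thesis using c by (simp add: field_simps)
  qed
  then show thesis by (rule that)
qed

section \<open>Weighted square-integrable functions and the Bergman projection\<close>

text \<open>Working with the squared norm avoids roots: it expands as a quadratic form, and it factorises over products
of functions of separate variables.\<close>

abbreviation L2_sq :: "('a::euclidean_space \<Rightarrow> real) \<Rightarrow> ('a \<Rightarrow> complex) \<Rightarrow> real" where
  "L2_sq \<psi> f \<equiv> integral\<^sup>L lebesgue (\<lambda>z. (cmod (f z))\<^sup>2 * exp (- 2 * \<psi> z))"

lemma measurable_cnj [measurable]: "cnj \<in> borel_measurable borel"
  by (intro borel_measurable_continuous_onI continuous_intros)

lemma measurable_complex_of_real [measurable]: "complex_of_real \<in> borel_measurable borel"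
  by (intro borel_measurable_continuous_onI continuous_intros)

lemma weight_measurable:
  "continuous_on UNIV \<psi> \<Longrightarrow> \<psi> \<in> borel_measurable lebesgue" for \<psi> :: "'a::euclidean_space \<Rightarrow> real"
  by (intro measurable_completion) (auto intro: borel_measurable_continuous_onI)

lemma L2_inner_integrable:
  assumes \<psi>: "continuous_on UNIV \<psi>" and f: "f \<in> L2 \<psi>" and g: "g \<in> L2 \<psi>"
  shows "integrable lebesgue (\<lambda>z. f z * cnj (g z) * of_real (exp (- 2 * \<psi> z)))"
proof -
  have [measurable]: "f \<in> borel_measurable lebesgue" "g \<in> borel_measurable lebesgue"
      "\<psi> \<in> borel_measurable lebesgue"
    using f g weight_measurable[OF \<psi>] by (auto simp: L2_def)
  have dom: "integrable lebesgue (\<lambda>z. (cmod (f z))\<^sup>2 * exp (- 2 * \<psi> z) + (cmod (g z))\<^sup>2 * exp (- 2 * \<psi> z))"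
    using f g by (simp add: L2_def)
  show ?thesis
  proof (rule Bochner_Integration.integrable_bound[OF dom])
    have "norm (f z * cnj (g z) * of_real (exp (- 2 * \<psi> z))) \<le>
        (cmod (f z))\<^sup>2 * exp (- 2 * \<psi> z) + (cmod (g z))\<^sup>2 * exp (- 2 * \<psi> z)" for z
      using mult_right_mono[OF mult_le_sum_squares[of "cmod (f z)" "cmod (g z)"], of "exp (- 2 * \<psi> z)"]
      by (simp add: norm_mult distrib_right)
    then show "AE z in lebesgue. norm (f z * cnj (g z) * of_real (exp (- 2 * \<psi> z))) \<le>
        norm ((cmod (f z))\<^sup>2 * exp (- 2 * \<psi> z) + (cmod (g z))\<^sup>2 * exp (- 2 * \<psi> z))"
      by (intro AE_I2) (metis abs_ge_self order_trans real_norm_def)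
  qed measurable
qed

lemma cmod_add_mult_square:
  "(cmod (a + c * b))\<^sup>2 = (cmod a)\<^sup>2 + 2 * Re (cnj c * (a * cnj b)) + (cmod c)\<^sup>2 * (cmod b)\<^sup>2"
  unfolding cmod_power2 by (simp add: power2_eq_square algebra_simps)

lemma
  assumes \<psi>: "continuous_on UNIV \<psi>" and f: "f \<in> L2 \<psi>" and g: "g \<in> L2 \<psi>"
  shows L2_add_mult: "(\<lambda>z. f z + c * g z) \<in> L2 \<psi>"
    and L2_sq_add_mult: "L2_sq \<psi> (\<lambda>z. f z + c * g z) =
        L2_sq \<psi> f + 2 * Re (cnj c * L2_inner \<psi> f g) + (cmod c)\<^sup>2 * L2_sq \<psi> g"
proof -
  let ?e = "\<lambda>z. exp (- 2 * \<psi> z)"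
  have intf: "integrable lebesgue (\<lambda>z. (cmod (f z))\<^sup>2 * ?e z)"
    and intg: "integrable lebesgue (\<lambda>z. (cmod (g z))\<^sup>2 * ?e z)"
    using f g by (auto simp: L2_def)
  note inti = L2_inner_integrable[OF \<psi> f g]
  have expand: "(cmod (f z + c * g z))\<^sup>2 * ?e z = (cmod (f z))\<^sup>2 * ?e z
      + 2 * Re (cnj c * (f z * cnj (g z) * of_real (?e z))) + (cmod c)\<^sup>2 * ((cmod (g z))\<^sup>2 * ?e z)" for z
    unfolding cmod_add_mult_square by (simp add: algebra_simps)
  have intr: "integrable lebesgue (\<lambda>z. Re (cnj c * (f z * cnj (g z) * of_real (?e z))))"
    using inti by (intro integrable_Re integrable_mult_right)
  have [measurable]: "f \<in> borel_measurable lebesgue" "g \<in> borel_measurable lebesgue"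
    using f g by (auto simp: L2_def)
  have "(\<lambda>z. f z + c * g z) \<in> borel_measurable lebesgue" by measurable
  then show "(\<lambda>z. f z + c * g z) \<in> L2 \<psi>"
    unfolding L2_def mem_Collect_eq expand using intf intg intr
    by (intro conjI Bochner_Integration.integrable_add integrable_mult_right)
  have Re_eq: "(\<integral>z. Re (cnj c * (f z * cnj (g z) * of_real (?e z))) \<partial>lebesgue) = Re (cnj c * L2_inner \<psi> f g)"
  proof -
    have "(\<integral>z. Re (cnj c * (f z * cnj (g z) * of_real (?e z))) \<partial>lebesgue) =
        Re (\<integral>z. cnj c * (f z * cnj (g z) * of_real (?e z)) \<partial>lebesgue)"
      by (rule integral_Re) (intro integrable_mult_right inti)
    also have "\<dots> = Re (cnj c * L2_inner \<psi> f g)"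
      unfolding L2_inner_def by (simp only: integral_mult_right_zero)
    finally show ?thesis .
  qed
  show "L2_sq \<psi> (\<lambda>z. f z + c * g z) =
        L2_sq \<psi> f + 2 * Re (cnj c * L2_inner \<psi> f g) + (cmod c)\<^sup>2 * L2_sq \<psi> g"
    unfolding expand Re_eq[symmetric]
    by (subst Bochner_Integration.integral_add, intro Bochner_Integration.integrable_add integrable_mult_right intf intr,
        intro integrable_mult_right intg, subst Bochner_Integration.integral_add, rule intf,
        intro integrable_mult_right intr) (simp only: integral_mult_right_zero)
qed

lemma L2_sq_nonneg: "0 \<le> L2_sq \<psi> f"
  by simp

lemma A2_1_add_mult:
  assumes "continuous_on UNIV \<psi>" "f \<in> A2_1 \<psi>" "g \<in> A2_1 \<psi>"
  shows "(\<lambda>z. f z + c * g z) \<in> A2_1 \<psi>"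
  using assms L2_add_mult[OF assms(1), of f g c] by (auto simp: A2_1_def intro!: holomorphic_intros)

text \<open>If moving from \<open>w\<close> in the direction of any multiple of \<open>H\<close> does not decrease the norm, then the
linear term of the quadratic expansion must vanish; the multiple \<open>- t \<langle>w, H\<rangle>\<close> with small
\<open>t > 0\<close> exhibits the contradiction otherwise.\<close>

lemma orthogonal_of_minimal:
  assumes \<psi>: "continuous_on UNIV \<psi>" and w: "w \<in> L2 \<psi>" and H: "H \<in> L2 \<psi>"
    and min: "\<And>c. L2_sq \<psi> w \<le> L2_sq \<psi> (\<lambda>z. w z + c * H z)"
  shows "L2_inner \<psi> w H = 0"
proof (rule ccontr)
  define s where "s = L2_inner \<psi> w H"
  define N where "N = L2_sq \<psi> H"
  \<comment> \<open>Any \<open>t\<close> with \<open>0 < t\<close> and \<open>t N < 2\<close> would do.\<close>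
  define t where "t = 1 / (N + 1)"
  assume "L2_inner \<psi> w H \<noteq> 0"
  then have s: "0 < (cmod s)\<^sup>2" by (simp add: s_def)
  have N: "0 \<le> N" unfolding N_def by (rule L2_sq_nonneg)
  have t: "0 < t" "t * N < 1" using N by (auto simp: t_def field_simps)
  have "Re (cnj (of_real (- t) * s) * s) = - t * (cmod s)\<^sup>2"
    unfolding cmod_power2 by (simp add: power2_eq_square algebra_simps)
  moreover have "(cmod (of_real (- t) * s))\<^sup>2 = t\<^sup>2 * (cmod s)\<^sup>2"
    by (simp add: norm_mult power_mult_distrib)
  ultimately have "0 \<le> 2 * (- t * (cmod s)\<^sup>2) + t\<^sup>2 * (cmod s)\<^sup>2 * N"
    using min[of "of_real (- t) * s"]
    unfolding L2_sq_add_mult[OF \<psi> w H] s_def[symmetric] N_def[symmetric] by simp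
  then have "0 \<le> (t * (cmod s)\<^sup>2) * (t * N - 2)"
    by (simp add: power2_eq_square algebra_simps)
  moreover have "(t * (cmod s)\<^sup>2) * (t * N - 2) < 0"
    using s t by (intro mult_pos_neg) auto
  ultimately show False by simp
qed

text \<open>The orthogonal projection onto \<open>A\<^sup>2(\<complex>, \<psi>)\<close>, obtained as a nearest point. Compactness comes from
holomorphy: a minimising sequence is bounded in norm, hence locally bounded, and Montel's theorem
extracts a pointwise limit \<open>h\<close>. By Fatou's lemma, \<open>h\<close> is at most as far from \<open>g\<close> as the infimum.\<close>

lemma A2_1_remainder_exists:
  assumes \<psi>: "continuous_on UNIV \<psi>" and g: "g \<in> L2 \<psi>"
  obtains h where "h \<in> A2_1 \<psi>" "\<And>H. H \<in> A2_1 \<psi> \<Longrightarrow> L2_inner \<psi> (\<lambda>z. g z - h z) H = 0"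
proof -
  let ?e = "\<lambda>z. exp (- 2 * \<psi> z)"
  let ?D = "\<lambda>h. L2_sq \<psi> (\<lambda>z. g z - h z)"
  define d where "d = (INF h\<in>A2_1 \<psi>. ?D h)"
  have A: "h \<in> L2 \<psi>" "h holomorphic_on UNIV" if "h \<in> A2_1 \<psi>" for h
    using that by (auto simp: A2_1_def)
  have [measurable]: "g \<in> borel_measurable lebesgue" "\<psi> \<in> borel_measurable lebesgue"
    using g weight_measurable[OF \<psi>] by (auto simp: L2_def)
  have bdd: "bdd_below (?D ` A2_1 \<psi>)"
    by (rule bdd_belowI2[of _ 0]) simp
  have lower: "d \<le> ?D h" if "h \<in> A2_1 \<psi>" for h
    unfolding d_def using that by (rule cINF_lower[OF bdd])
  have "(\<lambda>_. 0) \<in> A2_1 \<psi>" by (simp add: A2_1_def L2_def)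
  then have "A2_1 \<psi> \<noteq> {}" by blast
  then have "\<exists>h\<in>A2_1 \<psi>. ?D h < d + 1 / real (Suc n)" for n
    unfolding d_def by (intro cINF_less_iff[THEN iffD1] bdd) auto
  then obtain F where F: "\<And>n. F n \<in> A2_1 \<psi>" "\<And>n. ?D (F n) < d + 1 / real (Suc n)"
    by metis
  have diff: "(\<lambda>z. g z - h z) \<in> L2 \<psi>" if "h \<in> L2 \<psi>" for h
    using L2_add_mult[OF \<psi> g that, of "- 1"] by simp
  \<comment> \<open>From \<open>F n = g - (g - F n)\<close> and \<open>|a + b|\<^sup>2 \<le> 2 |a|\<^sup>2 + 2 |b|\<^sup>2\<close>.\<close>
  define B where "B = 2 * L2_sq \<psi> g + 2 * (d + 1)"
  have FB: "L2_sq \<psi> (F n) \<le> B" for n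
  proof -
    have "1 / real (Suc n) \<le> 1" by simp
    then have "?D (F n) \<le> d + 1" using F(2)[of n] by linarith
    have "L2_sq \<psi> (F n) \<le> (\<integral>z. 2 * ((cmod (g z))\<^sup>2 * ?e z) + 2 * ((cmod (g z - F n z))\<^sup>2 * ?e z) \<partial>lebesgue)"
    proof (rule Bochner_Integration.integral_mono)
      show "integrable lebesgue (\<lambda>z. (cmod (F n z))\<^sup>2 * ?e z)"
        using A(1)[OF F(1)] by (simp add: L2_def)
      show "integrable lebesgue (\<lambda>z. 2 * ((cmod (g z))\<^sup>2 * ?e z) + 2 * ((cmod (g z - F n z))\<^sup>2 * ?e z))"
        using g diff[OF A(1)[OF F(1)]]
        by (intro Bochner_Integration.integrable_add integrable_mult_right) (simp_all add: L2_def)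
      fix z
      have "cmod (F n z) \<le> cmod (g z) + cmod (g z - F n z)"
        by (metis add_diff_cancel_left' diff_add_cancel norm_triangle_ineq4 minus_diff_eq norm_minus_cancel)
      then have "(cmod (F n z))\<^sup>2 \<le> (cmod (g z) + cmod (g z - F n z))\<^sup>2"
        by (rule power_mono) simp
      also have "\<dots> \<le> 2 * (cmod (g z))\<^sup>2 + 2 * (cmod (g z - F n z))\<^sup>2"
        using sum_squares_bound[of "cmod (g z)" "cmod (g z - F n z)"] by (simp add: power2_sum)
      finally have "(cmod (F n z))\<^sup>2 * ?e z \<le> (2 * (cmod (g z))\<^sup>2 + 2 * (cmod (g z - F n z))\<^sup>2) * ?e z"
        by (rule mult_right_mono) simp
      then show "(cmod (F n z))\<^sup>2 * ?e z \<le> 2 * ((cmod (g z))\<^sup>2 * ?e z) + 2 * ((cmod (g z - F n z))\<^sup>2 * ?e z)"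
        by (simp only: distrib_right mult.assoc)
    qed
    also have "\<dots> = 2 * L2_sq \<psi> g + 2 * ?D (F n)"
      using g diff[OF A(1)[OF F(1)]] by (subst Bochner_Integration.integral_add) (simp_all add: L2_def)
    finally show ?thesis using \<open>?D (F n) \<le> d + 1\<close> by (simp add: B_def)
  qed
  obtain h r where h: "h holomorphic_on UNIV" and r: "strict_mono r"
    and lim: "\<And>z. (\<lambda>n. F (r n) z) \<longlonglongrightarrow> h z"
  proof (rule Montel[of UNIV "range F" F])
    show "\<exists>M. \<forall>f\<in>range F. \<forall>z\<in>K. norm (f z) \<le> M" if K: "compact K" for K
    proof -
      obtain C where C: "\<And>h p. h \<in> A2_1 \<psi> \<Longrightarrow> p \<in> K \<Longrightarrow>
          cmod (h p) \<le> C * ((\<integral>z. (cmod (h z))\<^sup>2 * ?e z \<partial>lborel) + 1)"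
        using A2_1_locally_bounded[OF \<psi> K] by blast
      have leb: "(\<integral>z. (cmod (F n z))\<^sup>2 * ?e z \<partial>lborel) = L2_sq \<psi> (F n)" for n
      proof (rule integral_completion[symmetric])
        have [measurable]: "F n \<in> borel_measurable borel" "\<psi> \<in> borel_measurable borel"
          using A(2)[OF F(1)] \<psi>
          by (auto intro: borel_measurable_continuous_onI holomorphic_on_imp_continuous_on)
        show "(\<lambda>z. (cmod (F n z))\<^sup>2 * ?e z) \<in> borel_measurable lborel" by measurable
      qed
      have "cmod (F n p) \<le> \<bar>C\<bar> * (B + 1)" if "p \<in> K" for n p
      proof -
        have "cmod (F n p) \<le> C * (L2_sq \<psi> (F n) + 1)"
          using C[OF F(1) that] unfolding leb .
        also have "\<dots> \<le> \<bar>C\<bar> * (B + 1)"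
          using FB[of n] L2_sq_nonneg[of "F n" \<psi>] by (intro mult_mono) auto
        finally show ?thesis .
      qed
      then show ?thesis by blast
    qed
  qed (use A(2) F(1) in auto)
  have [measurable]: "F n \<in> borel_measurable lebesgue" for n
    using A(1)[OF F(1)] by (simp add: L2_def)
  have [measurable]: "h \<in> borel_measurable lebesgue"
    using h by (intro measurable_completion)
       (auto intro: borel_measurable_continuous_onI holomorphic_on_imp_continuous_on)
  have Dlim: "(\<lambda>n. ?D (F (r n))) \<longlonglongrightarrow> d"
  proof (rule LIMSEQ_subseq_LIMSEQ[of "\<lambda>n. ?D (F n)" d r, unfolded o_def])
    have up: "(\<lambda>n. d + 1 / real (Suc n)) \<longlonglongrightarrow> d + 0"
      using LIMSEQ_inverse_real_of_nat by (intro tendsto_add tendsto_const) (simp add: inverse_eq_divide)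
    show "(\<lambda>n. ?D (F n)) \<longlonglongrightarrow> d"
      by (rule tendsto_sandwich[OF _ _ tendsto_const[of d] up[simplified add_0_right]])
         (use lower[OF F(1)] F(2) in \<open>auto intro!: always_eventually less_imp_le simp del: of_nat_Suc\<close>)
  qed (rule r)
  \<comment> \<open>The limit is only pointwise, so this inequality is also what shows that \<open>g - h\<close> is square integrable.\<close>
  have fatou: "(\<integral>\<^sup>+ z. ennreal ((cmod (g z - h z))\<^sup>2 * ?e z) \<partial>lebesgue) \<le> ennreal d"
  proof -
    have "(\<integral>\<^sup>+ z. ennreal ((cmod (g z - h z))\<^sup>2 * ?e z) \<partial>lebesgue) =
        (\<integral>\<^sup>+ z. liminf (\<lambda>n. ennreal ((cmod (g z - F (r n) z))\<^sup>2 * ?e z)) \<partial>lebesgue)"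
    proof (rule nn_integral_cong)
      fix z
      have "(\<lambda>n. ennreal ((cmod (g z - F (r n) z))\<^sup>2 * ?e z)) \<longlonglongrightarrow> ennreal ((cmod (g z - h z))\<^sup>2 * ?e z)"
        by (intro tendsto_intros lim)
      from lim_imp_Liminf[OF _ this]
      show "ennreal ((cmod (g z - h z))\<^sup>2 * ?e z) = liminf (\<lambda>n. ennreal ((cmod (g z - F (r n) z))\<^sup>2 * ?e z))"
        by simp
    qed
    also have "\<dots> \<le> liminf (\<lambda>n. \<integral>\<^sup>+ z. ennreal ((cmod (g z - F (r n) z))\<^sup>2 * ?e z) \<partial>lebesgue)"
      by (rule nn_integral_liminf) measurable
    also have "(\<lambda>n. \<integral>\<^sup>+ z. ennreal ((cmod (g z - F (r n) z))\<^sup>2 * ?e z) \<partial>lebesgue) = (\<lambda>n. ennreal (?D (F (r n))))"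
      using diff[OF A(1)[OF F(1)]] by (intro ext nn_integral_eq_integral) (auto simp: L2_def)
    also have "liminf \<dots> = ennreal d"
      using Dlim by (intro lim_imp_Liminf tendsto_ennrealI) auto
    finally show ?thesis .
  qed
  have w: "(\<lambda>z. g z - h z) \<in> L2 \<psi>"
    unfolding L2_def mem_Collect_eq
  proof (intro conjI integrableI_bounded)
    have "(\<integral>\<^sup>+ z. ennreal (norm ((cmod (g z - h z))\<^sup>2 * ?e z)) \<partial>lebesgue) \<le> ennreal d"
      using fatou by simp
    then show "(\<integral>\<^sup>+ z. ennreal (norm ((cmod (g z - h z))\<^sup>2 * ?e z)) \<partial>lebesgue) < \<infinity>"
      by (rule order_le_less_trans) simp
  qed measurable
  have wd: "?D h \<le> d"
  proof -
    have "0 \<le> d" using Dlim by (rule LIMSEQ_le_const) auto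
    have "ennreal (?D h) \<le> ennreal d"
      using fatou w by (subst nn_integral_eq_integral[symmetric]) (auto simp: L2_def)
    then show ?thesis using \<open>0 \<le> d\<close> by simp
  qed
  have hL2: "h \<in> L2 \<psi>"
    using L2_add_mult[OF \<psi> g w, of "- 1"] by simp
  then have hA: "h \<in> A2_1 \<psi>" using h by (simp add: A2_1_def)
  show thesis
  proof (rule that[OF hA])
    fix H assume H: "H \<in> A2_1 \<psi>"
    show "L2_inner \<psi> (\<lambda>z. g z - h z) H = 0"
    proof (rule orthogonal_of_minimal[OF \<psi> w A(1)[OF H]])
      fix c
      have eq: "g z - h z + c * H z = g z - (h z + - c * H z)" for z by simp
      show "?D h \<le> L2_sq \<psi> (\<lambda>z. g z - h z + c * H z)"
        unfolding eq by (rule order_trans[OF wd lower[OF A2_1_add_mult[OF \<psi> hA H]]])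
    qed
  qed
qed

section \<open>Orthonormal sequences\<close>

lemma L2_inner_add_mult_left:
  assumes \<psi>: "continuous_on UNIV \<psi>" and f: "f \<in> L2 \<psi>" and g: "g \<in> L2 \<psi>" and h: "h \<in> L2 \<psi>"
  shows "L2_inner \<psi> (\<lambda>z. f z + c * g z) h = L2_inner \<psi> f h + c * L2_inner \<psi> g h"
proof -
  note int = L2_inner_integrable[OF \<psi> f h] L2_inner_integrable[OF \<psi> g h]
  have "L2_inner \<psi> (\<lambda>z. f z + c * g z) h =
     (\<integral>z. f z * cnj (h z) * of_real (exp (- 2 * \<psi> z)) + c * (g z * cnj (h z) * of_real (exp (- 2 * \<psi> z))) \<partial>lebesgue)"
    unfolding L2_inner_def by (intro Bochner_Integration.integral_cong) (auto simp: algebra_simps)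
  also have "\<dots> = L2_inner \<psi> f h + c * L2_inner \<psi> g h"
    unfolding L2_inner_def
    by (subst Bochner_Integration.integral_add[OF int(1) integrable_mult_right[OF int(2)]])
       (simp only: integral_mult_right_zero)
  finally show ?thesis .
qed

lemma L2_inner_commute: "L2_inner \<psi> g f = cnj (L2_inner \<psi> f g)"
proof -
  have "cnj (L2_inner \<psi> f g) = (\<integral>z. cnj (f z * cnj (g z) * of_real (exp (- 2 * \<psi> z))) \<partial>lebesgue)"
    unfolding L2_inner_def by (rule Bochner_Integration.integral_cnj[symmetric])
  also have "\<dots> = L2_inner \<psi> g f"
    unfolding L2_inner_def by (intro Bochner_Integration.integral_cong) (auto simp: mult.commute)
  finally show ?thesis by simp
qed

lemma L2_inner_self: "L2_inner \<psi> f f = of_real (L2_sq \<psi> f)"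
  unfolding L2_inner_def integral_complex_of_real[symmetric]
  by (intro Bochner_Integration.integral_cong refl) (simp only: complex_norm_square of_real_mult)

text \<open>Subtracting a linear combination from an element of \<open>A\<^sup>2\<close>: the Gram-Schmidt step, with the
coefficients still free.\<close>

lemma A2_1_diff_sum:
  assumes \<psi>: "continuous_on UNIV \<psi>" and y: "y \<in> A2_1 \<psi>" and B: "finite B" "B \<subseteq> A2_1 \<psi>"
  shows "(\<lambda>z. y z - (\<Sum>b\<in>B. c b * b z)) \<in> A2_1 \<psi> \<and>
    (\<forall>h\<in>L2 \<psi>. L2_inner \<psi> (\<lambda>z. y z - (\<Sum>b\<in>B. c b * b z)) h =
       L2_inner \<psi> y h - (\<Sum>b\<in>B. c b * L2_inner \<psi> b h))"
  using B
proof (induction B rule: finite_induct)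
  case empty
  then show ?case using y by simp
next
  case (insert a B)
  have eq: "y z - (\<Sum>b\<in>insert a B. c b * b z) = (y z - (\<Sum>b\<in>B. c b * b z)) + (- c a) * a z" for z
    using insert.hyps by simp
  have IH: "(\<lambda>z. y z - (\<Sum>b\<in>B. c b * b z)) \<in> A2_1 \<psi>"
     "\<And>h. h \<in> L2 \<psi> \<Longrightarrow> L2_inner \<psi> (\<lambda>z. y z - (\<Sum>b\<in>B. c b * b z)) h =
       L2_inner \<psi> y h - (\<Sum>b\<in>B. c b * L2_inner \<psi> b h)"
    using insert.IH insert.prems by auto
  have a: "a \<in> A2_1 \<psi>" using insert.prems by simp
  show ?case
    unfolding eq
  proof (intro conjI ballI A2_1_add_mult[OF \<psi> IH(1) a])
    fix h assume h: "h \<in> L2 \<psi>"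
    have "(\<lambda>z. y z - (\<Sum>b\<in>B. c b * b z)) \<in> L2 \<psi>" "a \<in> L2 \<psi>"
      using IH(1) a by (simp_all add: A2_1_def)
    from L2_inner_add_mult_left[OF \<psi> this h, of "- c a"]
    show "L2_inner \<psi> (\<lambda>z. y z - (\<Sum>b\<in>B. c b * b z) + - c a * a z) h =
        L2_inner \<psi> y h - (\<Sum>b\<in>insert a B. c b * L2_inner \<psi> b h)"
      using IH(2)[OF h] insert.hyps by simp
  qed
qed

text \<open>On continuous functions the seminorm is a norm, since a continuous function that vanishes almost
everywhere vanishes everywhere.\<close>

lemma A2_1_L2_sq_pos:
  assumes \<psi>: "continuous_on UNIV \<psi>" and f: "f \<in> A2_1 \<psi>" and nz: "f z0 \<noteq> 0"
  shows "0 < L2_sq \<psi> f"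
proof -
  let ?N = "\<lambda>z. (cmod (f z))\<^sup>2 * exp (- 2 * \<psi> z)"
  have cont: "continuous_on UNIV ?N"
    using f \<psi> by (intro continuous_intros) (auto simp: A2_1_def holomorphic_on_imp_continuous_on)
  then have meas: "?N \<in> borel_measurable lborel"
    by (simp add: borel_measurable_continuous_onI)
  have int: "integrable lborel ?N"
    using f unfolding integrable_completion[OF meas, symmetric] by (simp only: A2_1_def L2_def mem_Collect_eq)
  have "0 < integral\<^sup>L lborel ?N"
    by (rule integral_continuous_pos[OF cont _ int, of z0]) (use nz in auto)
  then show ?thesis by (simp only: integral_completion[OF meas])
qed

text \<open>One step of Gram-Schmidt: a finite orthonormal set does not span an infinite-dimensional space, and an
element outside its span, minus its projection, can be normalised.\<close>

lemma orthonormal_extension: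
  assumes \<psi>: "continuous_on UNIV \<psi>" and inf: "infinite_dimensional (A2_1 \<psi>)"
    and B: "finite B" "B \<subseteq> A2_1 \<psi>"
    and ortho: "\<And>b b'. b \<in> B \<Longrightarrow> b' \<in> B \<Longrightarrow> L2_inner \<psi> b b' = (if b = b' then 1 else 0)"
  shows "\<exists>x\<in>A2_1 \<psi>. L2_inner \<psi> x x = 1 \<and> (\<forall>b\<in>B. L2_inner \<psi> x b = 0)"
proof -
  interpret V: vector_space "\<lambda>(c::complex) (f::complex \<Rightarrow> complex) z. c * f z"
    by (rule vector_space_complex_functions)
  obtain y where y: "y \<in> A2_1 \<psi>" "y \<notin> V.span B"
    using inf B(1) unfolding infinite_dimensional_def by blast
  define x where "x = (\<lambda>z. y z - (\<Sum>b\<in>B. L2_inner \<psi> y b * b z))"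
  have x: "x \<in> A2_1 \<psi>"
    and xh: "\<And>h. h \<in> L2 \<psi> \<Longrightarrow> L2_inner \<psi> x h = L2_inner \<psi> y h - (\<Sum>b\<in>B. L2_inner \<psi> y b * L2_inner \<psi> b h)"
    using A2_1_diff_sum[OF \<psi> y(1) B, of "L2_inner \<psi> y"] by (auto simp: x_def)
  have orth: "L2_inner \<psi> x b = 0" if b: "b \<in> B" for b
  proof -
    have "(\<Sum>b'\<in>B. L2_inner \<psi> y b' * L2_inner \<psi> b' b) = (\<Sum>b'\<in>B. if b' = b then L2_inner \<psi> y b' else 0)"
      using ortho b by (intro sum.cong) auto
    then show ?thesis using xh[of b] b B by (auto simp: A2_1_def)
  qed
  have "\<exists>z0. x z0 \<noteq> 0"
  proof (rule ccontr)
    assume "\<not> ?thesis"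
    then have "y z = (\<Sum>b\<in>B. L2_inner \<psi> y b * b z)" for z
      by (simp add: x_def)
    moreover have "(\<Sum>b\<in>B. (\<lambda>z. L2_inner \<psi> y b * b z)) = (\<lambda>z. \<Sum>b\<in>B. L2_inner \<psi> y b * b z)"
      using B(1) by (induction B rule: finite_induct) (auto simp: fun_eq_iff)
    ultimately have "y = (\<Sum>b\<in>B. (\<lambda>z. L2_inner \<psi> y b * b z))" by auto
    also have "\<dots> \<in> V.span B"
      by (intro V.span_sum V.span_scale V.span_base)
    finally show False using y(2) by simp
  qed
  then have pos: "0 < L2_sq \<psi> x" using A2_1_L2_sq_pos[OF \<psi> x] by blast
  define c where "c = complex_of_real (1 / sqrt (L2_sq \<psi> x))"
  define x' where "x' = (\<lambda>z. c * x z)"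
  have 0: "(\<lambda>_. 0) \<in> A2_1 \<psi>" by (simp add: A2_1_def L2_def)
  have x': "x' \<in> A2_1 \<psi>"
    using A2_1_add_mult[OF \<psi> 0 x, of c] by (simp add: x'_def)
  have L: "x \<in> L2 \<psi>" "(\<lambda>_. 0) \<in> L2 \<psi>" "x' \<in> L2 \<psi>" using x 0 x' by (auto simp: A2_1_def)
  have scale: "L2_inner \<psi> x' h = c * L2_inner \<psi> x h" if "h \<in> L2 \<psi>" for h
    using L2_inner_add_mult_left[OF \<psi> L(2,1) that, of c] by (simp add: x'_def L2_inner_def)
  have "L2_inner \<psi> x' x' = c * cnj (c * L2_inner \<psi> x x)"
    using scale[OF L(3)] L2_inner_commute[of \<psi> x x'] scale[OF L(1)] by simp
  also have "\<dots> = of_real ((1 / sqrt (L2_sq \<psi> x))\<^sup>2 * L2_sq \<psi> x)"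
    unfolding L2_inner_self c_def
    by (simp only: complex_cnj_mult complex_cnj_complex_of_real of_real_mult power2_eq_square mult.assoc)
  also have "(1 / sqrt (L2_sq \<psi> x))\<^sup>2 * L2_sq \<psi> x = 1"
    using pos by (simp add: power_divide)
  finally have "L2_inner \<psi> x' x' = 1" by simp
  moreover have "L2_inner \<psi> x' b = 0" if "b \<in> B" for b
    using scale[of b] orth[OF that] that B(2) by (auto simp: A2_1_def)
  ultimately show ?thesis using x' by blast
qed

text \<open>Each new member is chosen orthogonal to all earlier ones; orthogonality to later ones then follows
from the symmetry of the inner product.\<close>

lemma orthonormal_sequence_exists:
  assumes \<psi>: "continuous_on UNIV \<psi>" and inf: "infinite_dimensional (A2_1 \<psi>)"
  obtains f :: "nat \<Rightarrow> complex \<Rightarrow> complex"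
  where "\<And>m. f m \<in> A2_1 \<psi>"
    and "\<And>m p. L2_inner \<psi> (f m) (f p) = (if m = p then 1 else 0)"
proof -
  define P where "P f n r \<longleftrightarrow> r \<in> A2_1 \<psi> \<and> L2_inner \<psi> r r = 1 \<and>
      (\<forall>m<n. L2_inner \<psi> r (f m) = 0)" for f :: "nat \<Rightarrow> complex \<Rightarrow> complex" and n r
  have "\<exists>f. \<forall>n. P f n (f n)"
  proof (rule dependent_wellorder_choice)
    show "P f n r = P g n r" if "\<And>m. m < n \<Longrightarrow> f m = g m" for r f g n
      using that by (auto simp: P_def)
    fix n f assume IH: "\<And>m. m < n \<Longrightarrow> P f m (f m)"
    have zero: "L2_inner \<psi> (f i) (f j) = 0" if "i < n" "j < n" "i \<noteq> j" for i j
    proof (cases "j < i")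
      case True
      then show ?thesis using IH[OF \<open>i < n\<close>] by (auto simp: P_def)
    next
      case False
      then have "L2_inner \<psi> (f j) (f i) = 0" using that IH[OF \<open>j < n\<close>] by (auto simp: P_def)
      then show ?thesis by (subst L2_inner_commute) simp
    qed
    have "\<exists>x\<in>A2_1 \<psi>. L2_inner \<psi> x x = 1 \<and> (\<forall>b\<in>f ` {..<n}. L2_inner \<psi> x b = 0)"
    proof (rule orthonormal_extension[OF \<psi> inf])
      show "f ` {..<n} \<subseteq> A2_1 \<psi>" using IH by (auto simp: P_def)
      fix b b' assume "b \<in> f ` {..<n}" "b' \<in> f ` {..<n}"
      then show "L2_inner \<psi> b b' = (if b = b' then 1 else 0)"
        using zero IH by (auto simp: P_def)
    qed simp
    then show "\<exists>r. P f n r" by (auto simp: P_def)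
  qed
  then obtain f where f: "\<And>n. P f n (f n)" by blast
  show thesis
  proof (rule that)
    show "f m \<in> A2_1 \<psi>" for m using f by (auto simp: P_def)
    show "L2_inner \<psi> (f m) (f p) = (if m = p then 1 else 0)" for m p
    proof (cases m p rule: linorder_cases)
      case less
      then have "L2_inner \<psi> (f p) (f m) = 0" using f[of p] by (auto simp: P_def)
      then show ?thesis using less by (subst L2_inner_commute) simp
    qed (use f in \<open>auto simp: P_def\<close>)
  qed
qed

section \<open>Integration over coordinates\<close>

interpretation coords: product_sigma_finite "\<lambda>_::'n. lborel :: complex measure"
  by unfold_locales

text \<open>Lebesgue measure on \<open>\<complex>\<^sup>n\<close> is the product of \<open>n\<close> copies of Lebesgue measure on \<open>\<complex>\<close>. The product
measures live on functions from the index set, so integrals are transported along \<^const>\<open>vec_lambda\<close>.\<close>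

abbreviation coord_measure :: "'n::finite set \<Rightarrow> ('n \<Rightarrow> complex) measure" where
  "coord_measure I \<equiv> Pi\<^sub>M I (\<lambda>_. lborel)"

lemma measurable_vec_lambda [measurable]:
  "(\<lambda>x. \<chi> i. (x i :: complex)) \<in> coord_measure (UNIV :: 'n::finite set) \<rightarrow>\<^sub>M borel"
proof (subst borel_measurable_euclidean_space, intro ballI)
  fix b :: "complex^'n" assume "b \<in> Basis"
  then obtain i e where "b = axis i e" by (auto simp: Basis_vec_def)
  then show "(\<lambda>x. (\<chi> i. x i) \<bullet> b) \<in> borel_measurable (coord_measure UNIV)"
    by (simp add: inner_axis)
qed

text \<open>Lebesgue measure is determined by the volumes of boxes. A box in \<open>\<complex>\<^sup>n\<close> is a product of boxes in \<open>\<complex>\<close>,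
and its real edges are those of the factors taken together.\<close>

lemma lborel_eq_distr_vec_lambda:
  "(lborel :: (complex^'n::finite) measure) = distr (coord_measure UNIV) borel (\<lambda>x. \<chi> i. x i)"
proof (rule lborel_eqI)
  fix l u :: "complex^'n"
  assume le: "\<And>b. b \<in> Basis \<Longrightarrow> l \<bullet> b \<le> u \<bullet> b"
  have le_i: "l $ i \<bullet> e \<le> u $ i \<bullet> e" if "e \<in> Basis" for i e
    using le[of "axis i e"] that by (simp add: inner_axis axis_in_Basis_iff)
  have pre: "(\<lambda>x. \<chi> i. x i) -` box l u \<inter> space (coord_measure UNIV) = Pi\<^sub>E UNIV (\<lambda>i. box (l $ i) (u $ i))"
    by (auto simp: space_PiM PiE_iff mem_box Basis_vec_def inner_axis)
  have "emeasure (distr (coord_measure UNIV) borel (\<lambda>x. \<chi> i. x i)) (box l u) =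
      (\<Prod>i\<in>UNIV. emeasure lborel (box (l $ i) (u $ i)))"
    by (subst emeasure_distr[OF measurable_vec_lambda], simp,
        subst pre, subst coords.emeasure_PiM) auto
  also have "\<dots> = (\<Prod>i\<in>UNIV. ennreal (\<Prod>e\<in>Basis. (u $ i - l $ i) \<bullet> e))"
    using le_i by (intro prod.cong refl emeasure_lborel_box)
  also have "\<dots> = ennreal (\<Prod>i\<in>UNIV. \<Prod>e\<in>Basis. (u $ i - l $ i) \<bullet> e)"
    using le_i by (intro prod_ennreal prod_nonneg) (auto simp: inner_diff_left)
  also have "(\<Prod>i\<in>UNIV. \<Prod>e\<in>Basis. (u $ i - l $ i) \<bullet> e) = (\<Prod>b\<in>Basis. (u - l) \<bullet> b)"
  proof -
    have "(\<Prod>b\<in>Basis. (u - l) \<bullet> b) = (\<Prod>b\<in>(\<Union>i\<in>UNIV. axis i ` Basis). (u - l) \<bullet> b)"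
      by (intro prod.cong) (auto simp: Basis_vec_def)
    also have "\<dots> = (\<Prod>i\<in>UNIV. \<Prod>b\<in>axis i ` Basis. (u - l) \<bullet> b)"
      by (intro prod.UNION_disjoint) (auto simp: axis_eq_axis)
    also have "\<dots> = (\<Prod>i\<in>UNIV. \<Prod>e\<in>Basis. (u $ i - l $ i) \<bullet> e)"
      by (intro prod.cong refl, subst prod.reindex) (auto simp: inj_on_def axis_eq_axis inner_axis)
    finally show ?thesis by simp
  qed
  finally show "emeasure (distr (coord_measure UNIV) borel (\<lambda>x. \<chi> i. x i)) (box l u) =
      ennreal (\<Prod>b\<in>Basis. (u - l) \<bullet> b)" .
qed simp

lemma
  fixes f :: "complex^'n::finite \<Rightarrow> 'b::{banach, second_countable_topology}"
  assumes "f \<in> borel_measurable borel"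
  shows integral_lborel_vec: "(\<integral>z. f z \<partial>lborel) = (\<integral>x. f (\<chi> i. x i) \<partial>coord_measure UNIV)"
    and integrable_lborel_vec: "integrable lborel f \<longleftrightarrow> integrable (coord_measure UNIV) (\<lambda>x. f (\<chi> i. x i))"
  unfolding lborel_eq_distr_vec_lambda
  using assms by (auto intro!: integral_distr integrable_distr_eq)

lemma nn_integral_lborel_vec:
  fixes f :: "complex^'n::finite \<Rightarrow> ennreal"
  assumes "f \<in> borel_measurable borel"
  shows "(\<integral>\<^sup>+z. f z \<partial>lborel) = (\<integral>\<^sup>+x. f (\<chi> i. x i) \<partial>coord_measure UNIV)"
  unfolding lborel_eq_distr_vec_lambda using assms by (intro nn_integral_distr) auto

lemma
  fixes f :: "'n::finite \<Rightarrow> complex \<Rightarrow> 'b::{real_normed_field, banach, second_countable_topology}"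
  assumes f: "\<And>i. integrable lborel (f i)"
  shows integrable_prod_coords: "integrable lborel (\<lambda>z::complex^'n. \<Prod>i\<in>UNIV. f i (z $ i))"
    and integral_prod_coords: "(\<integral>z. (\<Prod>i\<in>UNIV. f i (z $ i)) \<partial>(lborel :: (complex^'n) measure)) = (\<Prod>i\<in>UNIV. \<integral>z. f i z \<partial>lborel)"
proof -
  have meas: "(\<lambda>z::complex^'n. \<Prod>i\<in>UNIV. f i (z $ i)) \<in> borel_measurable borel"
  proof (intro borel_measurable_prod)
    fix i
    have "(\<lambda>z::complex^'n. z $ i) \<in> borel_measurable borel"
      by (intro borel_measurable_continuous_onI continuous_intros)
    then show "(\<lambda>z::complex^'n. f i (z $ i)) \<in> borel_measurable borel"
      using borel_measurable_integrable[OF f[of i]] by (auto intro: measurable_compose)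
  qed
  show "integrable lborel (\<lambda>z::complex^'n. \<Prod>i\<in>UNIV. f i (z $ i))"
    unfolding integrable_lborel_vec[OF meas]
    using coords.product_integrable_prod[of UNIV f] f by simp
  show "(\<integral>z. (\<Prod>i\<in>UNIV. f i (z $ i)) \<partial>(lborel :: (complex^'n) measure)) = (\<Prod>i\<in>UNIV. \<integral>z. f i z \<partial>lborel)"
    unfolding integral_lborel_vec[OF meas]
    using coords.product_integral_prod[of UNIV f] f by simp
qed

lemma continuous_sum_weight:
  assumes "\<And>j. continuous_on UNIV (\<phi> j)"
  shows "continuous_on UNIV (sum_weight \<phi>)"
  unfolding sum_weight_def
  by (intro continuous_intros continuous_on_compose2[OF assms]) auto

lemma exp_sum_weight: "exp (- 2 * sum_weight \<phi> z) = (\<Prod>j\<in>UNIV. exp (- 2 * \<phi> j (z $ j)))"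
  unfolding sum_weight_def sum_distrib_left by (rule exp_sum) simp

text \<open>The weight of a sum is the product of the weights, so norms of products of functions of separate
variables are products of norms.\<close>

lemma
  fixes f :: "'n::finite \<Rightarrow> complex \<Rightarrow> complex"
  assumes \<phi>: "\<And>j. continuous_on UNIV (\<phi> j)"
    and f: "\<And>j. f j \<in> borel_measurable borel" "\<And>j. f j \<in> L2 (\<phi> j)"
  shows L2_prod_coords: "(\<lambda>z. \<Prod>j\<in>UNIV. f j (z $ j)) \<in> L2 (sum_weight \<phi>)"
    and L2_sq_prod_coords: "L2_sq (sum_weight \<phi>) (\<lambda>z. \<Prod>j\<in>UNIV. f j (z $ j)) = (\<Prod>j\<in>UNIV. L2_sq (\<phi> j) (f j))"
proof -
  have [measurable]: "\<And>j. \<phi> j \<in> borel_measurable borel" "sum_weight \<phi> \<in> borel_measurable borel"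
    using \<phi> continuous_sum_weight[of \<phi>, OF \<phi>] by (auto intro: borel_measurable_continuous_onI)
  have [measurable]: "(\<lambda>z::complex^'n. z $ i) \<in> borel_measurable borel" for i
    by (intro borel_measurable_continuous_onI continuous_intros)
  note f(1)[measurable]
  define N where "N j z = (cmod (f j z))\<^sup>2 * exp (- 2 * \<phi> j z)" for j z
  have N_meas: "N j \<in> borel_measurable lborel" for j
    unfolding N_def[abs_def] by measurable
  have N_int: "integrable lborel (N j)" for j
    unfolding integrable_completion[OF N_meas, symmetric]
    using f(2)[of j] by (simp only: N_def[abs_def] L2_def mem_Collect_eq)
  have F_meas: "(\<lambda>z. \<Prod>j\<in>UNIV. f j (z $ j)) \<in> borel_measurable (borel :: (complex^'n) measure)"
    by measurable
  have eq: "(cmod (\<Prod>j\<in>UNIV. f j (z $ j)))\<^sup>2 * exp (- 2 * sum_weight \<phi> z) = (\<Prod>j\<in>UNIV. N j (z $ j))" for z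
    unfolding exp_sum_weight N_def by (simp add: prod.distrib prod_power_distrib prod_norm[symmetric])
  have P_meas: "(\<lambda>z. \<Prod>j\<in>UNIV. N j (z $ j)) \<in> borel_measurable (lborel :: (complex^'n) measure)"
    unfolding N_def by measurable
  show "(\<lambda>z. \<Prod>j\<in>UNIV. f j (z $ j)) \<in> L2 (sum_weight \<phi>)"
    unfolding L2_def mem_Collect_eq eq integrable_completion[OF P_meas]
    using F_meas integrable_prod_coords[OF N_int] by (auto intro: measurable_completion)
  show "L2_sq (sum_weight \<phi>) (\<lambda>z. \<Prod>j\<in>UNIV. f j (z $ j)) = (\<Prod>j\<in>UNIV. L2_sq (\<phi> j) (f j))"
    unfolding eq integral_completion[OF P_meas] integral_prod_coords[OF N_int]
      integral_completion[OF N_meas, symmetric] by (simp only: N_def[abs_def])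
qed

lemma entire_imp_continuous: "entire h \<Longrightarrow> continuous_on UNIV h"
  unfolding entire_def
  by (metis continuous_at_imp_continuous_on has_derivative_continuous)

lemma entire_slice_holomorphic:
  assumes "entire h"
  shows "(\<lambda>y. h (\<chi> i. (x(k := y)) i)) holomorphic_on UNIV"
proof -
  have "\<exists>f'. ((\<lambda>y. h (\<chi> i. (x(k := y)) i)) has_field_derivative f') (at y)" for y
  proof -
    let ?v = "\<lambda>y. \<chi> i. (x(k := y)) i"
    obtain D where D: "(h has_derivative D) (at (?v y))" "\<And>c v. D (c *s v) = c * D v"
      using assms unfolding entire_def by blast
    have v_eq: "?v = (\<lambda>y'. (\<chi> i. (x(k := 0)) i) + axis k y')"
      by (auto simp: fun_eq_iff vec_eq_iff axis_def)
    have lin: "bounded_linear (axis k :: complex \<Rightarrow> complex^'a)"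
      by (rule linear_conv_bounded_linear[THEN iffD1])
         (auto intro!: linearI simp: vec_eq_iff axis_def)
    have "(?v has_derivative axis k) (at y)"
      unfolding v_eq
      using has_derivative_add[OF has_derivative_const bounded_linear_imp_has_derivative[OF lin]] by simp
    from has_derivative_compose[OF this D(1)]
    have "((\<lambda>y. h (?v y)) has_derivative (\<lambda>c. D (axis k c))) (at y)" .
    moreover have "(\<lambda>c. D (axis k c)) = (*) (D (axis k 1))"
    proof
      fix c :: complex
      have "axis k c = c *s axis k 1"
        by (auto simp: vec_eq_iff axis_def)
      then have "D (axis k c) = c * D (axis k 1)" by (simp only: D(2))
      then show "D (axis k c) = D (axis k 1) * c" by (simp only: mult.commute)
    qed
    ultimately have "((\<lambda>y. h (?v y)) has_derivative (*) (D (axis k 1))) (at y)"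
      by (simp only:)
    then show ?thesis
      unfolding has_field_derivative_def by (rule exI)
  qed
  then show ?thesis
    unfolding holomorphic_on_open[OF open_UNIV] by blast
qed

text \<open>Integrate over \<open>z\<^sub>k\<close> first. With the other variables fixed, the integrand is a constant times that of
the inner product of \<open>w\<close> with a slice of \<open>H\<close>. The slice is entire and, by Tonelli's theorem applied to
\<open>|H|\<^sup>2 e\<^sup>-\<^sup>2\<^sup>\<phi>\<close>, square integrable for almost all values of the other variables.\<close>

lemma L2_inner_coords_eq_0:
  fixes \<phi> :: "'n::finite \<Rightarrow> complex \<Rightarrow> real"
  assumes \<phi>: "\<And>j. continuous_on UNIV (\<phi> j)" and kl: "k \<noteq> l"
    and meas: "f \<in> borel_measurable borel" "w \<in> borel_measurable borel"
    and w: "\<And>H. H \<in> A2_1 (\<phi> k) \<Longrightarrow> L2_inner (\<phi> k) w H = 0"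
    and u: "(\<lambda>z. f (z $ l) * w (z $ k)) \<in> L2 (sum_weight \<phi>)"
    and H: "H \<in> A2 (sum_weight \<phi>)"
  shows "L2_inner (sum_weight \<phi>) (\<lambda>z. f (z $ l) * w (z $ k)) H = 0"
proof -
  let ?\<Phi> = "sum_weight \<phi>"
  define V where "V x y = (\<chi> i. (x(k := y)) i)" for x :: "'n \<Rightarrow> complex" and y
  define I where "I = - {k}"
  have I: "finite I" "k \<notin> I" "insert k I = UNIV" "l \<in> I" using kl by (auto simp: I_def)
  have H': "H \<in> L2 ?\<Phi>" "entire H" using H by (auto simp: A2_def)
  have [measurable]: "\<And>j. \<phi> j \<in> borel_measurable borel" "?\<Phi> \<in> borel_measurable borel"
      "H \<in> borel_measurable borel"
    using \<phi> continuous_sum_weight[of \<phi>, OF \<phi>] entire_imp_continuous[OF H'(2)]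
    by (auto intro: borel_measurable_continuous_onI)
  have [measurable]: "(\<lambda>z::complex^'n. z $ i) \<in> borel_measurable borel" for i
    by (intro borel_measurable_continuous_onI continuous_intros)
  note meas[measurable]
  define G where "G z = f (z $ l) * w (z $ k) * cnj (H z) * of_real (exp (- 2 * ?\<Phi> z))" for z
  define N where "N z = (cmod (H z))\<^sup>2 * exp (- 2 * ?\<Phi> z)" for z
  define E where "E x = exp (- 2 * (\<Sum>j\<in>I. \<phi> j (x j)))" for x
  have weight: "exp (- 2 * ?\<Phi> (V x y)) = E x * exp (- 2 * \<phi> k y)" for x y
  proof -
    have "?\<Phi> (V x y) = (\<Sum>j\<in>insert k I. \<phi> j ((x(k := y)) j))"
      by (simp add: sum_weight_def I(3) V_def)
    also have "\<dots> = \<phi> k y + (\<Sum>j\<in>I. \<phi> j (x j))"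
      using I by (subst sum.insert) (auto intro!: sum.cong)
    finally show ?thesis by (simp only: E_def distrib_left exp_add mult.commute)
  qed
  have G_meas: "G \<in> borel_measurable lborel" and N_meas: "N \<in> borel_measurable lborel"
    unfolding G_def[abs_def] N_def[abs_def] by measurable
  have G_int: "integrable lborel G"
    unfolding integrable_completion[OF G_meas, symmetric] G_def
    by (rule L2_inner_integrable[OF continuous_sum_weight[OF \<phi>] u H'(1)])
  have N_int: "integrable lborel N"
    unfolding integrable_completion[OF N_meas, symmetric]
    using H'(1) by (simp only: N_def[abs_def] L2_def mem_Collect_eq)
  have "(\<lambda>(x, y). x(k := y)) \<in> coord_measure I \<Otimes>\<^sub>M lborel \<rightarrow>\<^sub>M coord_measure UNIV"
    using measurable_add_dim[of k I "\<lambda>_. lborel"] I(3) by simp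
  from measurable_compose[OF this measurable_vec_lambda]
  have joint: "(\<lambda>p. V (fst p) (snd p)) \<in> coord_measure I \<Otimes>\<^sub>M lborel \<rightarrow>\<^sub>M borel"
    by (simp only: case_prod_beta V_def)
  have G_joint: "(\<lambda>p. G (V (fst p) (snd p))) \<in> borel_measurable (coord_measure I \<Otimes>\<^sub>M lborel)"
    by (rule measurable_compose[OF joint]) (use G_meas in simp)
  have N_joint: "(\<lambda>p. N (V (fst p) (snd p))) \<in> borel_measurable (coord_measure I \<Otimes>\<^sub>M lborel)"
    by (rule measurable_compose[OF joint]) (use N_meas in simp)
  have "(\<integral>\<^sup>+x. \<integral>\<^sup>+y. ennreal (N (V x y)) \<partial>lborel \<partial>coord_measure I) < \<infinity>"
  proof -
    have "(\<integral>\<^sup>+x. \<integral>\<^sup>+y. ennreal (N (V x y)) \<partial>lborel \<partial>coord_measure I) =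
        (\<integral>\<^sup>+x. ennreal (N (\<chi> i. x i)) \<partial>coord_measure (insert k I))"
      unfolding V_def
      by (rule coords.product_nn_integral_insert[OF I(1,2), symmetric])
         (use I(3) N_meas in \<open>auto intro!: measurable_compose[OF measurable_vec_lambda]\<close>)
    also have "\<dots> = (\<integral>\<^sup>+z. ennreal (N z) \<partial>lborel)"
      unfolding I(3) using N_meas by (intro nn_integral_lborel_vec[symmetric]) auto
    also have "\<dots> < \<infinity>"
      using N_int by (subst nn_integral_eq_integral) (auto simp: N_def)
    finally show ?thesis .
  qed
  then have finite_AE: "AE x in coord_measure I. (\<integral>\<^sup>+y. ennreal (N (V x y)) \<partial>lborel) \<noteq> \<infinity>"
  proof (intro nn_integral_PInf_AE lborel.borel_measurable_nn_integral)
    show "(\<lambda>(x, y). ennreal (N (V x y))) \<in> borel_measurable (coord_measure I \<Otimes>\<^sub>M lborel)"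
      using N_joint unfolding case_prod_beta by measurable
  qed simp
  have slice0: "(\<integral>y. G (V x y) \<partial>lborel) = 0"
    if fin: "(\<integral>\<^sup>+y. ennreal (N (V x y)) \<partial>lborel) \<noteq> \<infinity>" for x
  proof -
    let ?h = "\<lambda>y. H (V x y)"
    have hol: "?h holomorphic_on UNIV" unfolding V_def by (rule entire_slice_holomorphic[OF H'(2)])
    then have h_meas [measurable]: "?h \<in> borel_measurable borel"
      by (intro borel_measurable_continuous_onI holomorphic_on_imp_continuous_on)
    have "integrable lborel (\<lambda>y. N (V x y))"
    proof (rule integrableI_bounded)
      show "(\<lambda>y. N (V x y)) \<in> borel_measurable lborel"
        unfolding N_def weight by measurable
      show "(\<integral>\<^sup>+y. ennreal (norm (N (V x y))) \<partial>lborel) < \<infinity>"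
        using fin by (simp add: N_def less_top)
    qed
    then have "integrable lborel (\<lambda>y. (1 / E x) * N (V x y))"
      by (rule integrable_mult_right)
    also have "(\<lambda>y. (1 / E x) * N (V x y)) = (\<lambda>y. (cmod (?h y))\<^sup>2 * exp (- 2 * \<phi> k y))"
      unfolding N_def weight by (simp add: E_def)
    finally have "integrable lebesgue (\<lambda>y. (cmod (?h y))\<^sup>2 * exp (- 2 * \<phi> k y))"
      by (subst integrable_completion) auto
    moreover have "?h \<in> borel_measurable lebesgue"
      by (intro measurable_completion) simp
    ultimately have "?h \<in> A2_1 (\<phi> k)"
      using hol by (simp add: A2_1_def L2_def)
    then have "L2_inner (\<phi> k) w ?h = 0" by (rule w)
    then have 0: "(\<integral>y. w y * cnj (?h y) * of_real (exp (- 2 * \<phi> k y)) \<partial>lborel) = 0"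
      unfolding L2_inner_def by (subst (asm) integral_completion) auto
    have "G (V x y) = (f (x l) * of_real (E x)) * (w y * cnj (?h y) * of_real (exp (- 2 * \<phi> k y)))" for y
      unfolding G_def weight using kl by (simp add: V_def)
    then have "(\<integral>y. G (V x y) \<partial>lborel) =
        (f (x l) * of_real (E x)) * (\<integral>y. w y * cnj (?h y) * of_real (exp (- 2 * \<phi> k y)) \<partial>lborel)"
      by (simp only: integral_mult_right_zero)
    then show ?thesis by (simp only: 0 mult_zero_right)
  qed
  have "L2_inner ?\<Phi> (\<lambda>z. f (z $ l) * w (z $ k)) H = (\<integral>z. G z \<partial>lborel)"
    unfolding L2_inner_def G_def[symmetric] by (rule integral_completion[OF G_meas])
  also have "\<dots> = (\<integral>x. G (\<chi> i. x i) \<partial>coord_measure (insert k I))"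
    unfolding I(3) using G_meas by (intro integral_lborel_vec) auto
  also have "\<dots> = (\<integral>x. \<integral>y. G (V x y) \<partial>lborel \<partial>coord_measure I)"
    unfolding V_def using G_int G_meas integrable_lborel_vec[of G] I(3)
    by (intro coords.product_integral_insert[OF I(1,2)]) auto
  also have "\<dots> = (\<integral>x. 0 \<partial>coord_measure I)"
  proof (rule integral_cong_AE)
    show "AE x in coord_measure I. (\<integral>y. G (V x y) \<partial>lborel) = 0"
      using finite_AE by eventually_elim (rule slice0)
    show "(\<lambda>x. \<integral>y. G (V x y) \<partial>lborel) \<in> borel_measurable (coord_measure I)"
      using G_joint by (intro lborel.borel_measurable_lebesgue_integral) (simp only: split_beta')
  qed simp
  finally show ?thesis by simp
qed

section \<open>Test functions and pairings in several variables\<close>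

lemma C_k_coord: "C_k m g \<Longrightarrow> C_k m (\<lambda>z::complex^'n::finite. g (z $ i))"
  using C_k_affine_comp[of "\<lambda>z::complex^'n. z $ i" m g 0] bounded_linear_vec_nth by auto

text \<open>In the Leibniz rule, all factors but the one in the variable of differentiation are differentiated in
the direction \<open>0\<close>, so a single term survives.\<close>

lemma dzbar_prod_coords:
  fixes c :: "'n::finite \<Rightarrow> complex \<Rightarrow> complex"
  assumes c: "\<And>i. C_k (Suc 0) (c i)"
  shows "dzbar j (\<lambda>z. \<Prod>i\<in>UNIV. c i (z $ i)) z = dzbar_1 (c j) (z $ j) * (\<Prod>i\<in>UNIV - {j}. c i (z $ i))"
proof -
  have der: "((\<lambda>z. c i (z $ i)) has_derivative (\<lambda>v. frechet_derivative (c i) (at (z $ i)) (v $ i))) (at z)" for i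
    by (rule has_derivative_compose[OF bounded_linear_imp_has_derivative[OF bounded_linear_vec_nth]
          C_k_Suc_has_derivative[OF c]])
  have D: "frechet_derivative (\<lambda>z. \<Prod>i\<in>UNIV. c i (z $ i)) (at z) v =
     (\<Sum>i\<in>UNIV. frechet_derivative (c i) (at (z $ i)) (v $ i) * (\<Prod>m\<in>UNIV - {i}. c m (z $ m)))" for v
  proof -
    have "((\<lambda>z. \<Prod>i\<in>UNIV. c i (z $ i)) has_derivative
        (\<lambda>v. \<Sum>i\<in>UNIV. frechet_derivative (c i) (at (z $ i)) (v $ i) * (\<Prod>m\<in>UNIV - {i}. c m (z $ m)))) (at z)"
      by (rule has_derivative_prod) (rule der)
    from frechet_derivative_at[OF this, symmetric] show ?thesis by simp
  qed
  have zero: "frechet_derivative (c i) (at x) 0 = 0" for i x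
    by (rule linear_0[OF has_derivative_linear[OF C_k_Suc_has_derivative[OF c]]])
  have "frechet_derivative (\<lambda>z. \<Prod>i\<in>UNIV. c i (z $ i)) (at z) (axis j e) =
     frechet_derivative (c j) (at (z $ j)) e * (\<Prod>m\<in>UNIV - {j}. c m (z $ m))" for e
  proof -
    have "frechet_derivative (\<lambda>z. \<Prod>i\<in>UNIV. c i (z $ i)) (at z) (axis j e) =
      (\<Sum>i\<in>UNIV. if i = j then frechet_derivative (c j) (at (z $ j)) e * (\<Prod>m\<in>UNIV - {j}. c m (z $ m)) else 0)"
      unfolding D by (intro sum.cong refl) (auto simp: axis_def zero)
    then show ?thesis by simp
  qed
  then show ?thesis
    by (simp add: dzbar_def dzbar_1_def field_simps)
qed

lemma integral_dzbar_by_parts: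
  fixes u \<eta> :: "complex^'n::finite \<Rightarrow> complex"
  assumes u: "C_k (Suc 0) u" and \<eta>: "test_function \<eta>"
  shows "integral\<^sup>L lebesgue (\<lambda>z. u z * dzbar j \<eta> z) = - integral\<^sup>L lebesgue (\<lambda>z. dzbar j u z * \<eta> z)"
proof -
  have \<eta>': "C_k (Suc 0) \<eta>" "compact (closure {z. \<eta> z \<noteq> 0})"
    using \<eta> unfolding test_function_def C_infinity_def by blast+
  have cont: "continuous_on UNIV (dzbar j g)" if "C_k (Suc 0) g" for g :: "complex^'n \<Rightarrow> complex"
    using that unfolding dzbar_def[abs_def] by (intro continuous_intros) auto
  have "(\<lambda>z. u z * dzbar j \<eta> z) \<in> borel_measurable lborel" "(\<lambda>z. dzbar j u z * \<eta> z) \<in> borel_measurable lborel"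
    using continuous_on_mult[OF C_k_imp_continuous[OF u] cont[OF \<eta>'(1)]]
      continuous_on_mult[OF cont[OF u] C_k_imp_continuous[OF \<eta>'(1)]]
    by (auto intro: borel_measurable_continuous_onI)
  note leb = this[THEN integral_completion]
  show ?thesis
    unfolding leb unfolding dzbar_def by (rule integral_by_parts_wirtinger[OF u \<eta>'])
qed

text \<open>The dual of \<open>L\<^sup>2(\<psi>)\<close> under the unweighted pairing is \<open>L\<^sup>2(- \<psi>)\<close>. The bound plays
the part of the Cauchy-Schwarz inequality, with a free parameter in place of square roots: choosing
\<open>s\<close> large makes the \<open>K\<close> part small while \<open>u\<close> is still to be sent to zero.\<close>

lemma
  fixes u K :: "'a::euclidean_space \<Rightarrow> complex"
  assumes \<psi>: "continuous_on UNIV \<psi>" and u: "u \<in> L2 \<psi>" and K: "K \<in> L2 (\<lambda>z. - \<psi> z)"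
  shows L2_pairing_integrable: "integrable lebesgue (\<lambda>z. u z * K z)"
    and L2_pairing_bound: "0 < s \<Longrightarrow>
      cmod (integral\<^sup>L lebesgue (\<lambda>z. u z * K z)) \<le> s * L2_sq \<psi> u + L2_sq (\<lambda>z. - \<psi> z) K / s"
proof -
  have [measurable]: "u \<in> borel_measurable lebesgue" "K \<in> borel_measurable lebesgue"
    using u K by (auto simp: L2_def)
  let ?b = "\<lambda>s z. s * ((cmod (u z))\<^sup>2 * exp (- 2 * \<psi> z)) + (1 / s) * ((cmod (K z))\<^sup>2 * exp (- 2 * - \<psi> z))"
  have iu: "integrable lebesgue (\<lambda>z. (cmod (u z))\<^sup>2 * exp (- 2 * \<psi> z))"
    and iK: "integrable lebesgue (\<lambda>z. (cmod (K z))\<^sup>2 * exp (- 2 * - \<psi> z))"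
    using u K unfolding L2_def mem_Collect_eq by blast+
  have ib: "integrable lebesgue (?b s)" for s
    by (intro Bochner_Integration.integrable_add integrable_mult_right iu iK)
  have bound: "cmod (u z * K z) \<le> ?b s z" if s: "0 < s" for s z
  proof -
    have "cmod (u z * K z) = (sqrt s * cmod (u z) * exp (- \<psi> z)) * (cmod (K z) / sqrt s * exp (\<psi> z))"
      using s by (simp add: norm_mult exp_minus)
    also have "\<dots> \<le> (sqrt s * cmod (u z) * exp (- \<psi> z))\<^sup>2 + (cmod (K z) / sqrt s * exp (\<psi> z))\<^sup>2"
      using s by (intro mult_le_sum_squares) auto
    also have "\<dots> = ?b s z"
      unfolding power_mult_exp using s by (simp add: power_mult_distrib power_divide)
    finally show ?thesis .
  qed
  show int: "integrable lebesgue (\<lambda>z. u z * K z)"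
  proof (rule Bochner_Integration.integrable_bound[OF ib[of 1]])
    show "AE z in lebesgue. norm (u z * K z) \<le> norm (?b 1 z)"
      by (intro AE_I2 order_trans[OF bound[of 1]]) auto
  qed measurable
  assume s: "0 < s"
  have "cmod (integral\<^sup>L lebesgue (\<lambda>z. u z * K z)) \<le> integral\<^sup>L lebesgue (?b s)"
    by (rule Bochner_Integration.integral_norm_bound_integral[OF int ib]) (rule bound[OF s])
  also have "\<dots> = s * L2_sq \<psi> u + 1 / s * L2_sq (\<lambda>z. - \<psi> z) K"
    by (subst Bochner_Integration.integral_add[OF integrable_mult_right[OF iu] integrable_mult_right[OF iK]])
       (simp only: integral_mult_right_zero)
  finally show "cmod (integral\<^sup>L lebesgue (\<lambda>z. u z * K z)) \<le> s * L2_sq \<psi> u + L2_sq (\<lambda>z. - \<psi> z) K / s"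
    by simp
qed

lemma prod_two_coords:
  assumes "k \<noteq> l"
  shows "(\<Prod>i\<in>(UNIV::'n::finite set). (if i = l then f else if i = k then g else (\<lambda>_. 1)) (z i)) =
     f (z l) * (g (z k) :: 'a::comm_monoid_mult)"
proof -
  have "(\<Prod>i\<in>UNIV. (if i = l then f else if i = k then g else (\<lambda>_. 1)) (z i)) =
     (\<Prod>i\<in>UNIV. (if i = l then f (z l) else 1) * (if i = k then g (z k) else 1))"
    using assms by (intro prod.cong) auto
  then show ?thesis by (simp add: prod.distrib)
qed

text \<open>A product can only be nonzero where all factors are, so the support is bounded in every variable.\<close>

lemma test_function_prod_coords:
  fixes c :: "'n::finite \<Rightarrow> complex \<Rightarrow> complex"
  assumes c: "\<And>i m. C_k m (c i)" and supp: "\<And>i z. R \<le> cmod z \<Longrightarrow> c i z = 0"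
  shows "test_function (\<lambda>z. \<Prod>i\<in>UNIV. c i (z $ i))"
proof -
  have "cmod (z $ i) \<le> R" if "(\<Prod>i\<in>UNIV. c i (z $ i)) \<noteq> 0" for z :: "complex^'n" and i
    using that supp[of "z $ i" i] by (force simp: not_le[symmetric] intro: ccontr)
  then have "norm z \<le> (\<Sum>i\<in>(UNIV::'n set). R)" if "(\<Prod>i\<in>UNIV. c i (z $ i)) \<noteq> 0" for z :: "complex^'n"
    unfolding norm_vec_def using that by (intro order_trans[OF L2_set_le_sum] sum_mono) auto
  then have "bounded {z::complex^'n. (\<Prod>i\<in>UNIV. c i (z $ i)) \<noteq> 0}"
    unfolding bounded_iff by blast
  moreover have "C_k m (\<lambda>z::complex^'n. \<Prod>i\<in>UNIV. c i (z $ i))" for m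
    by (intro C_k_prod C_k_coord c)
  ultimately show ?thesis
    by (simp add: test_function_def C_infinity_def compact_closure)
qed

section \<open>The forms and their canonical solutions\<close>

definition coord_form :: "'n \<Rightarrow> 'n \<Rightarrow> (complex \<Rightarrow> complex) \<Rightarrow> 'n::finite form01" where
  "coord_form k l f j = (if j = k then (\<lambda>z. f (z $ l)) else (\<lambda>_. 0))"

lemma prod_one_coord:
  "(\<Prod>i\<in>(UNIV::'n::finite set). (if i = l then f else (\<lambda>_. 1)) (z i)) = (f (z l) :: 'a::comm_monoid_mult)"
proof -
  have "(\<Prod>i\<in>UNIV. (if i = l then f else (\<lambda>_. 1)) (z i)) = (\<Prod>i\<in>UNIV. if i = l then f (z l) else 1)"
    by (intro prod.cong) auto
  then show ?thesis by simp
qed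

lemma entire_coord:
  fixes l :: "'n::finite"
  assumes "f holomorphic_on UNIV"
  shows "entire (\<lambda>z::complex^'n. f (z $ l))"
  unfolding entire_def
proof (intro allI exI conjI)
  fix z :: "complex^'n"
  have "(f has_derivative (*) (deriv f (z $ l))) (at (z $ l))"
    using holomorphic_derivI[OF assms, of "z $ l"] by (simp add: has_field_derivative_def)
  then show "((\<lambda>z. f (z $ l)) has_derivative (\<lambda>v. deriv f (z $ l) * (v $ l))) (at z)"
    by (rule has_derivative_compose[OF bounded_linear_imp_has_derivative[OF bounded_linear_vec_nth]])
qed simp

lemma A2_1_measurable: "f \<in> A2_1 \<psi> \<Longrightarrow> f \<in> borel_measurable borel"
  by (auto simp: A2_1_def intro!: borel_measurable_continuous_onI holomorphic_on_imp_continuous_on)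

text \<open>The remaining variables contribute the norms of the constant function, so the norm of \<open>f(z\<^sub>l)\<close> on \<open>\<complex>\<^sup>n\<close>
depends on \<open>f\<close> only through its norm on \<open>\<complex>\<close>.\<close>

lemma
  fixes \<phi> :: "'n::finite \<Rightarrow> complex \<Rightarrow> real"
  assumes \<phi>: "\<And>j. continuous_on UNIV (\<phi> j)" and one: "\<And>j. (\<lambda>_. 1) \<in> L2 (\<phi> j)"
    and f: "f \<in> A2_1 (\<phi> l)"
  shows L2_coord: "(\<lambda>z. f (z $ l)) \<in> L2 (sum_weight \<phi>)"
    and L2_sq_coord: "L2_sq (sum_weight \<phi>) (\<lambda>z. f (z $ l)) =
        (\<Prod>j\<in>UNIV. if j = l then L2_sq (\<phi> l) f else L2_sq (\<phi> j) (\<lambda>_. 1))"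
proof -
  define c where "c i = (if i = l then f else (\<lambda>_. 1))" for i
  have c: "c i \<in> borel_measurable borel" "c i \<in> L2 (\<phi> i)" for i
    using f one A2_1_measurable[OF f] by (auto simp: c_def A2_1_def)
  have eq: "(\<lambda>z. \<Prod>i\<in>UNIV. c i (z $ i)) = (\<lambda>z. f (z $ l))"
    unfolding c_def by (rule ext) (rule prod_one_coord)
  show "(\<lambda>z. f (z $ l)) \<in> L2 (sum_weight \<phi>)"
    using L2_prod_coords[of \<phi> c, OF \<phi> c] unfolding eq .
  have "L2_sq (sum_weight \<phi>) (\<lambda>z. f (z $ l)) = (\<Prod>j\<in>UNIV. L2_sq (\<phi> j) (c j))"
    using L2_sq_prod_coords[of \<phi> c, OF \<phi> c] unfolding fun_cong[OF eq] .
  also have "\<dots> = (\<Prod>j\<in>UNIV. if j = l then L2_sq (\<phi> l) f else L2_sq (\<phi> j) (\<lambda>_. 1))"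
    by (intro prod.cong refl) (simp add: c_def)
  finally show "L2_sq (sum_weight \<phi>) (\<lambda>z. f (z $ l)) =
        (\<Prod>j\<in>UNIV. if j = l then L2_sq (\<phi> l) f else L2_sq (\<phi> j) (\<lambda>_. 1))" .
qed

lemma zero_in_L2: "(\<lambda>_. 0) \<in> L2 \<psi>"
  by (simp add: L2_def)

lemma coord_form_A2_01:
  fixes \<phi> :: "'n::finite \<Rightarrow> complex \<Rightarrow> real"
  assumes \<phi>: "\<And>j. continuous_on UNIV (\<phi> j)" and one: "\<And>j. (\<lambda>_. 1) \<in> L2 (\<phi> j)"
    and f: "f \<in> A2_1 (\<phi> l)"
  shows "coord_form k l f \<in> A2_01 (sum_weight \<phi>)"
proof -
  have "f holomorphic_on UNIV" using f by (simp add: A2_1_def)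
  then have "entire (coord_form k l f j)" for j
    using entire_coord[of f l] entire_coord[of "\<lambda>_. 0" l] by (auto simp: coord_form_def)
  moreover have "coord_form k l f j \<in> L2 (sum_weight \<phi>)" for j
    using L2_coord[of \<phi>, OF \<phi> one f] zero_in_L2 by (auto simp: coord_form_def)
  ultimately show ?thesis
    by (auto simp: A2_01_def L2_01_def)
qed

lemma L2_01_norm_coord_form:
  fixes \<phi> :: "'n::finite \<Rightarrow> complex \<Rightarrow> real"
  shows "L2_01_norm (sum_weight \<phi>) (coord_form k l f) = sqrt (L2_sq (sum_weight \<phi>) (\<lambda>z. f (z $ l)))"
proof -
  have "(\<Sum>j\<in>UNIV. (L2_norm (sum_weight \<phi>) (coord_form k l f j))\<^sup>2) =
      (\<Sum>j\<in>UNIV. if j = k then L2_sq (sum_weight \<phi>) (\<lambda>z. f (z $ l)) else 0)"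
    by (intro sum.cong refl) (auto simp: coord_form_def L2_norm_def)
  then show ?thesis by (simp add: L2_01_norm_def)
qed

lemma C_k_if:
  assumes "C_k m a" "C_k m b"
  shows "C_k m (if P then a else b)"
  using assms by simp

lemma dzbar_1_one: "dzbar_1 (\<lambda>_. 1) z = 0"
  by (rule dzbar_1_holomorphic) simp

text \<open>Integration by parts moves the derivative to \<open>f(z\<^sub>l)\<close>, which is holomorphic in all variables. Both
sides of the closedness condition for \<^const>\<open>coord_form\<close> vanish for this reason.\<close>

lemma integral_holomorphic_coord_dzbar:
  assumes f: "f holomorphic_on UNIV" and \<eta>: "test_function \<eta>"
  shows "integral\<^sup>L lebesgue (\<lambda>z::complex^'n::finite. f (z $ l) * dzbar j \<eta> z) = 0"
proof -
  define c where "c i = (if i = l then f else (\<lambda>_. 1))" for i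
  have c: "C_k (Suc 0) (c i)" for i
    unfolding c_def by (intro C_k_if C_k_holomorphic[OF f] C_k_const)
  have eq: "(\<lambda>z::complex^'n. f (z $ l)) = (\<lambda>z. \<Prod>i\<in>UNIV. c i (z $ i))"
    unfolding c_def by (rule ext) (rule prod_one_coord[symmetric])
  have "dzbar_1 (c j) x = 0" for x
    using dzbar_1_holomorphic[OF f] dzbar_1_one by (simp add: c_def)
  then have "dzbar j (\<lambda>z::complex^'n. f (z $ l)) z = 0" for z
    unfolding eq dzbar_prod_coords[OF c] by simp
  then show ?thesis
    using integral_dzbar_by_parts[OF C_k_coord[OF C_k_holomorphic[OF f]] \<eta>, of l j] by simp
qed

lemma dzbar_1_cnj_diff:
  assumes h: "h holomorphic_on UNIV"
  shows "dzbar_1 (\<lambda>z. cnj z - h z) z = 1"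
proof -
  have "(h has_derivative (*) (deriv h z)) (at z)"
    using holomorphic_derivI[OF h, of z] by (simp add: has_field_derivative_def)
  from has_derivative_diff[OF bounded_linear_imp_has_derivative[OF bounded_linear_cnj] this]
  have "((\<lambda>z. cnj z - h z) has_derivative (\<lambda>v. cnj v - deriv h z * v)) (at z)" .
  from frechet_derivative_at[OF this, symmetric] show ?thesis
    by (simp add: dzbar_1_def field_simps)
qed

lemma C_k_cnj_diff:
  assumes "h holomorphic_on UNIV"
  shows "C_k m (\<lambda>z. cnj z - h z)"
  using C_k_add[OF C_k_linear[OF bounded_linear_cnj] C_k_mult[OF C_k_const[of m "-1"] C_k_holomorphic[OF assms]]]
  by simp

text \<open>The conjugate derivative of \<open>cnj - h\<close> is \<open>1\<close> when \<open>h\<close> is holomorphic, and the other factors are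
holomorphic; integration by parts turns this classical solution into one in the sense of distributions.\<close>

lemma dbar_eq_coord_form:
  fixes k l :: "'n::finite"
  assumes kl: "k \<noteq> l" and f: "f holomorphic_on UNIV" and h: "h holomorphic_on UNIV"
  shows "dbar_eq (\<lambda>z. f (z $ l) * (cnj (z $ k) - h (z $ k))) (coord_form k l f)"
  unfolding dbar_eq_def
proof (intro allI impI)
  fix j :: 'n and \<eta> :: "complex^'n \<Rightarrow> complex"
  assume \<eta>: "test_function \<eta>"
  define w where "w z = cnj z - h z" for z
  define c where "c i = (if i = l then f else if i = k then w else (\<lambda>_. 1))" for i
  have c: "C_k (Suc 0) (c i)" for i
    unfolding c_def w_def[abs_def] by (intro C_k_if C_k_holomorphic[OF f] C_k_const C_k_cnj_diff[OF h])
  have eq: "(\<lambda>z::complex^'n. f (z $ l) * (cnj (z $ k) - h (z $ k))) = (\<lambda>z. \<Prod>i\<in>UNIV. c i (z $ i))"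
    unfolding c_def w_def[symmetric] by (rule ext) (rule prod_two_coords[OF kl, symmetric])
  have "dzbar j (\<lambda>z. \<Prod>i\<in>UNIV. c i (z $ i)) z = coord_form k l f j z" for z :: "complex^'n"
  proof (cases "j = k")
    case True
    have "dzbar_1 (c j) (z $ j) = 1"
      using True kl dzbar_1_cnj_diff[OF h] by (simp add: c_def w_def[abs_def])
    moreover have "(\<Prod>i\<in>UNIV - {j}. c i (z $ i)) = (\<Prod>i\<in>UNIV - {j}. if i = l then f (z $ l) else 1)"
      using True by (intro prod.cong) (auto simp: c_def)
    ultimately show ?thesis
      unfolding dzbar_prod_coords[OF c] using True kl by (simp add: coord_form_def)
  next
    case False
    then have "dzbar_1 (c j) (z $ j) = 0"
      using dzbar_1_holomorphic[OF f] dzbar_1_one by (simp add: c_def)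
    then show ?thesis
      unfolding dzbar_prod_coords[OF c] using False by (simp add: coord_form_def)
  qed
  moreover have "C_k (Suc 0) (\<lambda>z::complex^'n. \<Prod>i\<in>UNIV. c i (z $ i))"
    by (intro C_k_prod C_k_coord c)
  ultimately show "integral\<^sup>L lebesgue (\<lambda>z. (f (z $ l) * (cnj (z $ k) - h (z $ k))) * dzbar j \<eta> z) =
      - integral\<^sup>L lebesgue (\<lambda>z. coord_form k l f j z * \<eta> z)"
    unfolding fun_cong[OF eq]
    using integral_dzbar_by_parts[OF _ \<eta>, of "\<lambda>z. \<Prod>i\<in>UNIV. c i (z $ i)" j] by simp
qed

text \<open>The function \<open>f(z\<^sub>l) w(z\<^sub>k)\<close>, where \<open>w\<close> is \<open>cnj\<close> minus its projection to \<open>A\<^sup>2(\<complex>, \<phi>\<^sub>k)\<close>, is a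
canonical solution. So the defining property of the operator, which is a choice, holds for whichever
representative is chosen.\<close>

lemma canonical_solution_coord_form:
  fixes \<phi> :: "'n::finite \<Rightarrow> complex \<Rightarrow> real"
  assumes \<phi>: "\<And>j. continuous_on UNIV (\<phi> j)" and one: "\<And>j. (\<lambda>_. 1) \<in> L2 (\<phi> j)"
    and kl: "k \<noteq> l" and cnj: "cnj \<in> L2 (\<phi> k)" and f: "f \<in> A2_1 (\<phi> l)"
  shows "coord_form k l f \<in> canonical_domain (sum_weight \<phi>)"
    and "is_canonical_solution (sum_weight \<phi>) (coord_form k l f)
           (canonical_solution (sum_weight \<phi>) (coord_form k l f))"
proof -
  obtain h where h: "h \<in> A2_1 (\<phi> k)"
    and orth: "\<And>H. H \<in> A2_1 (\<phi> k) \<Longrightarrow> L2_inner (\<phi> k) (\<lambda>z. cnj z - h z) H = 0"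
    using A2_1_remainder_exists[OF \<phi> cnj] by blast
  have hol: "f holomorphic_on UNIV" "h holomorphic_on UNIV" using f h by (auto simp: A2_1_def)
  define w where "w z = cnj z - h z" for z
  define c where "c i = (if i = l then f else if i = k then w else (\<lambda>_. 1))" for i
  have w_L2: "w \<in> L2 (\<phi> k)"
    using L2_add_mult[OF \<phi> cnj, of h "-1"] h by (simp add: w_def[abs_def] A2_1_def)
  have w_meas: "w \<in> borel_measurable borel"
    unfolding w_def[abs_def]
    by (rule borel_measurable_continuous_onI[OF C_k_imp_continuous[OF C_k_cnj_diff[OF hol(2)]]])
  have c: "c i \<in> borel_measurable borel" "c i \<in> L2 (\<phi> i)" for i
    using f one A2_1_measurable[OF f] w_L2 w_meas by (auto simp: c_def A2_1_def)
  have eq: "(\<lambda>z. \<Prod>i\<in>UNIV. c i (z $ i)) = (\<lambda>z. f (z $ l) * w (z $ k))"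
    unfolding c_def by (rule ext) (rule prod_two_coords[OF kl])
  have u_L2: "(\<lambda>z. f (z $ l) * w (z $ k)) \<in> L2 (sum_weight \<phi>)"
    using L2_prod_coords[of \<phi> c, OF \<phi> c] unfolding eq .
  have u_eq: "dbar_eq (\<lambda>z. f (z $ l) * w (z $ k)) (coord_form k l f)"
    unfolding w_def by (rule dbar_eq_coord_form[OF kl hol])
  have "L2_inner (sum_weight \<phi>) (\<lambda>z. f (z $ l) * w (z $ k)) H = 0" if "H \<in> A2 (sum_weight \<phi>)" for H
    by (rule L2_inner_coords_eq_0[OF \<phi> kl A2_1_measurable[OF f] w_meas _ u_L2 that])
       (use orth in \<open>simp add: w_def[abs_def]\<close>)
  then have "is_canonical_solution (sum_weight \<phi>) (coord_form k l f) (\<lambda>z. f (z $ l) * w (z $ k))"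
    unfolding is_canonical_solution_def using u_L2 u_eq by blast
  then show "is_canonical_solution (sum_weight \<phi>) (coord_form k l f)
           (canonical_solution (sum_weight \<phi>) (coord_form k l f))"
    unfolding canonical_solution_def by (rule someI[of "is_canonical_solution (sum_weight \<phi>) (coord_form k l f)"])
  have "dbar_closed (coord_form k l f)"
    unfolding dbar_closed_def
    using integral_holomorphic_coord_dzbar[OF hol(1)] by (auto simp: coord_form_def)
  moreover have "coord_form k l f \<in> L2_01 (sum_weight \<phi>)"
    using coord_form_A2_01[of \<phi>, OF \<phi> one f] by (simp add: A2_01_def)
  ultimately show "coord_form k l f \<in> canonical_domain (sum_weight \<phi>)"
    unfolding canonical_domain_def using u_L2 u_eq by blast
qed

section \<open>Pairing solutions with a kernel\<close>

text \<open>The kernel is the derivative in the conjugate of \<open>z\<^sub>k\<close> of a product in which variable \<open>l\<close> carries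
\<open>cnj g\<close> times the weight, and every other variable carries a bump. The factor in \<open>z\<^sub>l\<close> turns
integration against \<open>f(z\<^sub>l)\<close> into the weighted inner product of \<open>f\<close> and \<open>g\<close>.\<close>

definition kernel_factor ::
  "('n \<Rightarrow> complex \<Rightarrow> real) \<Rightarrow> 'n \<Rightarrow> 'n \<Rightarrow> (complex \<Rightarrow> complex) \<Rightarrow> 'n \<Rightarrow> complex \<Rightarrow> complex" where
  "kernel_factor \<phi> k l g i =
     (if i = l then (\<lambda>z. cnj (g z) * of_real (exp (- 2 * \<phi> l z)))
      else if i = k then dzbar_1 (bump 1) else bump 1)"

definition pairing_kernel ::
  "('n::finite \<Rightarrow> complex \<Rightarrow> real) \<Rightarrow> 'n \<Rightarrow> 'n \<Rightarrow> (complex \<Rightarrow> complex) \<Rightarrow> complex^'n \<Rightarrow> complex" where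
  "pairing_kernel \<phi> k l g z = (\<Prod>i\<in>UNIV. kernel_factor \<phi> k l g i (z $ i))"

lemma continuous_dzbar_1: "C_k (Suc 0) f \<Longrightarrow> continuous_on UNIV (dzbar_1 f)"
  unfolding dzbar_1_def[abs_def] by (intro continuous_intros) auto

lemma dzbar_1_bump_eq_0: "1 \<le> cmod z \<Longrightarrow> dzbar_1 (bump p) z = 0"
  by (simp add: dzbar_1_bump bump_eq_0)

lemma L2_compact_support:
  assumes \<psi>: "continuous_on UNIV \<psi>" and f: "continuous_on UNIV f"
    and supp: "\<And>z::complex. 1 \<le> cmod z \<Longrightarrow> f z = 0"
  shows "f \<in> L2 \<psi>"
proof -
  have cont: "continuous_on UNIV (\<lambda>z. (cmod (f z))\<^sup>2 * exp (- 2 * \<psi> z))"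
    by (intro continuous_intros \<psi> f)
  have "integrable lborel (\<lambda>z. (cmod (f z))\<^sup>2 * exp (- 2 * \<psi> z))"
    by (rule integrable_compact_support[OF cont compact_cball[of 0 1]]) (use supp in auto)
  moreover have "(\<lambda>z. (cmod (f z))\<^sup>2 * exp (- 2 * \<psi> z)) \<in> borel_measurable lborel"
    using cont by (simp add: borel_measurable_continuous_onI)
  moreover have "f \<in> borel_measurable lebesgue"
    using f by (intro measurable_completion) (simp add: borel_measurable_continuous_onI)
  ultimately show ?thesis
    unfolding L2_def mem_Collect_eq by (subst integrable_completion) auto
qed

text \<open>In the variable \<open>l\<close> the weight appears squared in \<open>|cnj g e\<^sup>-\<^sup>2\<^sup>\<phi>|\<^sup>2\<close>, and one copy cancels against
\<open>e\<^sup>2\<^sup>\<phi>\<close>, leaving the norm of \<open>g\<close>.\<close>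

lemma kernel_factor_L2:
  assumes \<phi>: "\<And>j. continuous_on UNIV (\<phi> j)" and g: "g \<in> A2_1 (\<phi> l)"
  shows "kernel_factor \<phi> k l g i \<in> borel_measurable borel"
    and "kernel_factor \<phi> k l g i \<in> L2 (\<lambda>z. - \<phi> i z)"
    and "L2_sq (\<lambda>z. - \<phi> l z) (kernel_factor \<phi> k l g l) = L2_sq (\<phi> l) g"
proof -
  have contb: "continuous_on UNIV (bump 1)" "continuous_on UNIV (dzbar_1 (bump 1))"
    using C_k_imp_continuous[OF C_k_bump] continuous_dzbar_1[OF C_k_bump] by auto
  have g_hol: "g holomorphic_on UNIV" and g_L2: "g \<in> L2 (\<phi> l)" using g by (auto simp: A2_1_def)
  have cont_l: "continuous_on UNIV (\<lambda>z. cnj (g z) * of_real (exp (- 2 * \<phi> l z)))"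
    by (intro continuous_intros \<phi> holomorphic_on_imp_continuous_on g_hol)
  then have cont: "continuous_on UNIV (kernel_factor \<phi> k l g i)"
    using contb by (simp add: kernel_factor_def)
  then show "kernel_factor \<phi> k l g i \<in> borel_measurable borel"
    by (rule borel_measurable_continuous_onI)
  have eq: "(cmod (cnj (g z) * of_real (exp (- 2 * \<phi> l z))))\<^sup>2 * exp (- 2 * - \<phi> l z) =
      (cmod (g z))\<^sup>2 * exp (- 2 * \<phi> l z)" for z
  proof -
    have "(cmod (cnj (g z) * of_real (exp (- 2 * \<phi> l z))))\<^sup>2 = (cmod (g z) * exp (- 2 * \<phi> l z))\<^sup>2"
      by (simp add: norm_mult)
    then show ?thesis
      unfolding power_mult_exp by (simp add: mult.assoc flip: exp_add)
  qed
  then show "L2_sq (\<lambda>z. - \<phi> l z) (kernel_factor \<phi> k l g l) = L2_sq (\<phi> l) g"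
    by (simp only: kernel_factor_def refl if_True)
  have neg: "continuous_on UNIV (\<lambda>z. - \<phi> i z)" by (intro continuous_intros \<phi>)
  show "kernel_factor \<phi> k l g i \<in> L2 (\<lambda>z. - \<phi> i z)"
  proof (cases "i = l")
    case True
    have "(\<lambda>z. cnj (g z) * of_real (exp (- 2 * \<phi> l z))) \<in> borel_measurable lebesgue"
      using cont_l by (intro measurable_completion) (simp add: borel_measurable_continuous_onI)
    moreover have "integrable lebesgue (\<lambda>z. (cmod (g z))\<^sup>2 * exp (- 2 * \<phi> l z))"
      using g_L2 unfolding L2_def by blast
    ultimately show ?thesis
      unfolding True L2_def mem_Collect_eq kernel_factor_def eq[symmetric] by (simp only: if_True simp_thms)
  next
    case False
    then show ?thesis
      by (intro L2_compact_support[OF neg cont]) (auto simp: kernel_factor_def bump_eq_0 dzbar_1_bump_eq_0)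
  qed
qed

text \<open>The dual norm of the kernel depends on \<open>g\<close> only through the norm of \<open>g\<close>, so it is the same for all
members of an orthonormal sequence.\<close>

lemma
  fixes \<phi> :: "'n::finite \<Rightarrow> complex \<Rightarrow> real"
  assumes \<phi>: "\<And>j. continuous_on UNIV (\<phi> j)" and g: "g \<in> A2_1 (\<phi> l)"
  shows pairing_kernel_L2: "pairing_kernel \<phi> k l g \<in> L2 (\<lambda>z. - sum_weight \<phi> z)"
    and L2_sq_pairing_kernel: "L2_sq (\<lambda>z. - sum_weight \<phi> z) (pairing_kernel \<phi> k l g) =
      (\<Prod>i\<in>UNIV. if i = l then L2_sq (\<phi> l) g
         else L2_sq (\<lambda>z. - \<phi> i z) (if i = k then dzbar_1 (bump 1) else bump 1))"
proof -
  have neg: "continuous_on UNIV (\<lambda>z. - \<phi> j z)" for j by (intro continuous_intros \<phi>)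
  have weight: "sum_weight (\<lambda>j z. - \<phi> j z) = (\<lambda>z. - sum_weight \<phi> z)"
    by (simp add: sum_weight_def fun_eq_iff sum_negf)
  have K: "(\<lambda>z. \<Prod>i\<in>UNIV. kernel_factor \<phi> k l g i (z $ i)) = pairing_kernel \<phi> k l g"
    by (simp add: pairing_kernel_def fun_eq_iff)
  note kf = kernel_factor_L2[of \<phi> g l k, OF \<phi> g]
  show "pairing_kernel \<phi> k l g \<in> L2 (\<lambda>z. - sum_weight \<phi> z)"
    using L2_prod_coords[of "\<lambda>j z. - \<phi> j z" "kernel_factor \<phi> k l g", OF neg kf(1,2)] unfolding K weight .
  have "L2_sq (\<lambda>z. - sum_weight \<phi> z) (pairing_kernel \<phi> k l g) =
      (\<Prod>i\<in>UNIV. L2_sq (\<lambda>z. - \<phi> i z) (kernel_factor \<phi> k l g i))"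
    using L2_sq_prod_coords[of "\<lambda>j z. - \<phi> j z" "kernel_factor \<phi> k l g", OF neg kf(1,2)]
    unfolding fun_cong[OF K] fun_cong[OF weight] .
  also have "\<dots> = (\<Prod>i\<in>UNIV. if i = l then L2_sq (\<phi> l) g
         else L2_sq (\<lambda>z. - \<phi> i z) (if i = k then dzbar_1 (bump 1) else bump 1))"
  proof (intro prod.cong refl)
    fix i
    show "L2_sq (\<lambda>z. - \<phi> i z) (kernel_factor \<phi> k l g i) = (if i = l then L2_sq (\<phi> l) g
         else L2_sq (\<lambda>z. - \<phi> i z) (if i = k then dzbar_1 (bump 1) else bump 1))"
    proof (cases "i = l")
      case True
      then show ?thesis by (simp only: kf(3) refl if_True)
    next
      case False
      then show ?thesis by (simp only: kernel_factor_def if_False)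
    qed
  qed
  finally show "L2_sq (\<lambda>z. - sum_weight \<phi> z) (pairing_kernel \<phi> k l g) =
      (\<Prod>i\<in>UNIV. if i = l then L2_sq (\<phi> l) g
         else L2_sq (\<lambda>z. - \<phi> i z) (if i = k then dzbar_1 (bump 1) else bump 1))" .
qed

lemma cmod_bump_1_le: "cmod (bump 1 z) \<le> 1"
  by (simp add: bump_def flat_def)

lemma bump_1_0: "bump 1 0 \<noteq> 0"
  by (simp add: bump_def flat_def)

lemma bump_1_dilate_tendsto: "(\<lambda>n. bump 1 (z * of_real (1 / real (Suc n)))) \<longlonglongrightarrow> bump 1 0"
proof -
  have "isCont (bump 1) 0"
    using C_k_imp_continuous[OF C_k_bump] by (simp add: continuous_on_eq_continuous_at)
  moreover have "(\<lambda>n. z * of_real (1 / real (Suc n))) \<longlonglongrightarrow> z * of_real 0"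
    using LIMSEQ_inverse_real_of_nat by (intro tendsto_intros) (simp add: inverse_eq_divide)
  ultimately show ?thesis by (intro isCont_tendsto_compose[of _ "bump 1"]) auto
qed

lemma dilated_bump_eq_0: "real (Suc n) \<le> cmod z \<Longrightarrow> bump p (z * of_real (1 / real (Suc n))) = 0"
  by (rule bump_eq_0) (simp add: norm_mult norm_divide divide_simps del: of_nat_Suc)

text \<open>Multiply the factor of the kernel in \<open>z\<^sub>l\<close> by a bump dilated by \<open>n + 1\<close>; this produces genuine test
functions \<open>\<eta>\<^sub>n\<close>, and they are smooth because the weight is. As \<open>n\<close> grows, the dilated bumps
converge to their value at \<open>0\<close>, a positive constant rather than \<open>1\<close>, and both sides of the equation
tested against \<open>\<eta>\<^sub>n\<close> converge by dominated convergence. The constant then cancels.\<close>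

lemma pairing_identity:
  fixes \<phi> :: "'n::finite \<Rightarrow> complex \<Rightarrow> real"
  assumes smooth: "\<And>j. C_infinity (\<phi> j)" and kl: "k \<noteq> l"
    and f: "f \<in> A2_1 (\<phi> l)" and g: "g \<in> A2_1 (\<phi> l)"
    and u: "u \<in> L2 (sum_weight \<phi>)" and u_eq: "dbar_eq u (coord_form k l f)"
  shows "integral\<^sup>L lebesgue (\<lambda>z. u z * pairing_kernel \<phi> k l g z) =
      - (L2_inner (\<phi> l) f g * (\<Prod>i\<in>UNIV - {l}. of_real (bump_mass 1)))"
proof -
  let ?K = "pairing_kernel \<phi> k l g"
  let ?d = "kernel_factor \<phi> k l g"
  let ?I = "\<Prod>i\<in>UNIV - {l}. complex_of_real (bump_mass 1)"
  have Ck: "C_k m (\<phi> j)" for m j using smooth by (auto simp: C_infinity_def)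
  have \<phi>: "continuous_on UNIV (\<phi> j)" for j by (rule C_k_imp_continuous[OF Ck])
  have hol: "f holomorphic_on UNIV" "g holomorphic_on UNIV" using f g by (auto simp: A2_1_def)
  define b where "b n z = bump 1 (z * of_real (1 / real (Suc n)))" for n and z :: complex
  have b_C_k: "C_k m (b n)" for m n
    using C_k_affine_comp[OF bounded_linear_mult_left[of "of_real (1 / real (Suc n))"] C_k_bump[of m 1], of 0]
    unfolding b_def[abs_def] by simp
  have b_le: "cmod (b n z) \<le> 1" for n z unfolding b_def by (rule cmod_bump_1_le)
  have b_lim: "(\<lambda>n. b n z) \<longlonglongrightarrow> bump 1 0" for z unfolding b_def by (rule bump_1_dilate_tendsto)
  have b_supp: "real (Suc n) \<le> cmod z \<Longrightarrow> b n z = 0" for n z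
    unfolding b_def by (rule dilated_bump_eq_0)
  define c where "c n i = (if i = l then (\<lambda>z. ?d l z * b n z) else bump 1)" for n i
  define \<eta> where "\<eta> n z = (\<Prod>i\<in>UNIV. c n i (z $ i))" for n and z :: "complex^'n"
  have c_C_k: "C_k m (c n i)" for m n i
  proof -
    have "C_k m (\<lambda>z. cnj (g z) * of_real (exp (- 2 * \<phi> l z)))"
      by (rule C_k_mult[OF C_k_linear_image[OF bounded_linear_cnj C_k_holomorphic[OF hol(2)]]
          C_k_linear_image[OF bounded_linear_of_real C_k_exp[OF C_k_mult[OF C_k_const Ck]]]])
    then have "C_k m (\<lambda>z. ?d l z * b n z)"
      by (simp only: kernel_factor_def refl if_True) (rule C_k_mult[OF _ b_C_k])
    then show ?thesis using C_k_bump by (simp add: c_def)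
  qed
  have test: "test_function (\<eta> n)" for n
    unfolding \<eta>_def[abs_def]
  proof (rule test_function_prod_coords[OF c_C_k])
    fix i and z :: complex assume z: "real (Suc n) \<le> cmod z"
    then have "1 \<le> cmod z" by (simp add: order_trans[rotated])
    then show "c n i z = 0" using b_supp[OF z] by (simp add: c_def bump_eq_0)
  qed
  \<comment> \<open>Since \<open>k \<noteq> l\<close>, the derivative does not see the cutoff.\<close>
  have dz: "dzbar k (\<eta> n) z = b n (z $ l) * ?K z" for n and z :: "complex^'n"
  proof -
    have "dzbar k (\<eta> n) z = dzbar_1 (bump 1) (z $ k) * (\<Prod>i\<in>UNIV - {k}. c n i (z $ i))"
      unfolding \<eta>_def[abs_def] dzbar_prod_coords[OF c_C_k] using kl by (simp add: c_def)
    also have "(\<Prod>i\<in>UNIV - {k}. c n i (z $ i)) =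
        (\<Prod>i\<in>UNIV - {k}. ?d i (z $ i) * (if i = l then b n (z $ l) else 1))"
      by (intro prod.cong) (auto simp: c_def kernel_factor_def)
    also have "\<dots> = (\<Prod>i\<in>UNIV - {k}. ?d i (z $ i)) * b n (z $ l)"
      using kl by (simp add: prod.distrib)
    finally show ?thesis
      using kl by (simp add: pairing_kernel_def prod.remove[of UNIV k] kernel_factor_def)
  qed
  have uK: "integrable lebesgue (\<lambda>z. u z * ?K z)"
    by (rule L2_pairing_integrable[OF continuous_sum_weight[of \<phi>, OF \<phi>] u
          pairing_kernel_L2[of \<phi>, OF \<phi> g]])
  have b_coord: "(\<lambda>z::complex^'n. b n (z $ l)) \<in> borel_measurable lebesgue" for n
    by (intro measurable_completion)
       (simp add: borel_measurable_continuous_onI[OF C_k_imp_continuous[OF C_k_coord[OF b_C_k]]])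
  \<comment> \<open>The bumps are bounded by \<open>1\<close>, so \<open>|u K|\<close> dominates.\<close>
  have lhs: "(\<lambda>n. integral\<^sup>L lebesgue (\<lambda>z. u z * dzbar k (\<eta> n) z)) \<longlonglongrightarrow>
      integral\<^sup>L lebesgue (\<lambda>z. bump 1 0 * (u z * ?K z))"
  proof (rule integral_dominated_convergence)
    show "integrable lebesgue (\<lambda>z. norm (u z * ?K z))" using uK by (rule integrable_norm)
    show "(\<lambda>z. bump 1 0 * (u z * ?K z)) \<in> borel_measurable lebesgue"
      using uK by (intro borel_measurable_integrable integrable_mult_right)
    have eq: "u z * dzbar k (\<eta> n) z = b n (z $ l) * (u z * ?K z)" for n z
      by (simp add: dz)
    show "(\<lambda>z. u z * dzbar k (\<eta> n) z) \<in> borel_measurable lebesgue" for n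
      unfolding eq by (intro borel_measurable_times b_coord borel_measurable_integrable[OF uK])
    show "AE z in lebesgue. (\<lambda>n. u z * dzbar k (\<eta> n) z) \<longlonglongrightarrow> bump 1 0 * (u z * ?K z)"
      unfolding eq by (intro AE_I2 tendsto_mult b_lim tendsto_const)
    show "AE z in lebesgue. norm (u z * dzbar k (\<eta> n) z) \<le> norm (u z * ?K z)" for n
      unfolding eq
      by (intro AE_I2) (simp only: norm_mult[of "b _ _"] mult_left_le_one_le b_le norm_ge_zero)
  qed
  define P where "P z = f z * ?d l z" for z
  have P_eq: "P z = f z * cnj (g z) * of_real (exp (- 2 * \<phi> l z))" for z
    by (simp add: P_def kernel_factor_def)
  have P_cont: "continuous_on UNIV P"
    unfolding P_eq[abs_def] by (intro continuous_intros \<phi> holomorphic_on_imp_continuous_on hol)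
  then have P_meas: "P \<in> borel_measurable lborel" by (simp add: borel_measurable_continuous_onI)
  have P_int: "integrable lborel P"
    unfolding integrable_completion[OF P_meas, symmetric] unfolding P_eq[abs_def]
    using L2_inner_integrable[OF \<phi>, of f l g] f g by (simp add: A2_1_def)
  have P_inner: "(\<integral>z. P z \<partial>lborel) = L2_inner (\<phi> l) f g"
    unfolding integral_completion[OF P_meas, symmetric] unfolding L2_inner_def P_eq[abs_def] ..
  have bP_meas: "(\<lambda>z. b n z * P z) \<in> borel_measurable lborel" for n
    using continuous_on_mult[OF C_k_imp_continuous[OF b_C_k] P_cont]
    by (simp add: borel_measurable_continuous_onI)
  have bP_bound: "norm (b n z * P z) \<le> norm (P z)" for n z
    by (simp only: norm_mult mult_left_le_one_le b_le norm_ge_zero)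
  have bP_int: "integrable lborel (\<lambda>z. b n z * P z)" for n
    by (rule Bochner_Integration.integrable_bound[OF P_int bP_meas]) (simp only: bP_bound AE_I2)
  have bP_lim: "(\<lambda>n. \<integral>z. b n z * P z \<partial>lborel) \<longlonglongrightarrow> (\<integral>z. bump 1 0 * P z \<partial>lborel)"
  proof (rule integral_dominated_convergence)
    show "integrable lborel (\<lambda>z. norm (P z))" using P_int by (rule integrable_norm)
    show "AE z in lborel. (\<lambda>n. b n z * P z) \<longlonglongrightarrow> bump 1 0 * P z"
      by (intro AE_I2 tendsto_mult b_lim tendsto_const)
    show "AE z in lborel. norm (b n z * P z) \<le> norm (P z)" for n
      by (simp only: bP_bound AE_I2)
    show "(\<lambda>z. bump 1 0 * P z) \<in> borel_measurable lborel"
      using P_int by (intro borel_measurable_integrable integrable_mult_right)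
  qed (rule bP_meas)
  have rhs: "integral\<^sup>L lebesgue (\<lambda>z. coord_form k l f k z * \<eta> n z) = (\<integral>z. b n z * P z \<partial>lborel) * ?I" for n
  proof -
    define e where "e i = (if i = l then (\<lambda>z. b n z * P z) else bump 1)" for i
    have e_int: "integrable lborel (e i)" for i
      using bP_int integrable_bump by (simp add: e_def)
    have eq: "coord_form k l f k z * \<eta> n z = (\<Prod>i\<in>UNIV. e i (z $ i))" for z
    proof -
      have "f (z $ l) * (\<Prod>i\<in>UNIV. c n i (z $ i)) =
          (\<Prod>i\<in>UNIV. (if i = l then f (z $ l) else 1) * c n i (z $ i))"
        by (simp add: prod.distrib)
      also have "\<dots> = (\<Prod>i\<in>UNIV. e i (z $ i))"
        by (intro prod.cong refl) (auto simp: e_def c_def P_def mult_ac)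
      finally show ?thesis by (simp add: coord_form_def \<eta>_def)
    qed
    have "(\<lambda>z. \<Prod>i\<in>UNIV. e i (z $ i)) \<in> borel_measurable (lborel :: (complex^'n) measure)"
      using integrable_prod_coords[OF e_int] by (rule borel_measurable_integrable)
    then have "integral\<^sup>L lebesgue (\<lambda>z. coord_form k l f k z * \<eta> n z) = (\<Prod>i\<in>UNIV. \<integral>z. e i z \<partial>lborel)"
      unfolding eq by (subst integral_completion) (auto simp: integral_prod_coords[OF e_int])
    also have "\<dots> = (\<integral>z. e l z \<partial>lborel) * (\<Prod>i\<in>UNIV - {l}. \<integral>z. e i z \<partial>lborel)"
      by (rule prod.remove) auto
    also have "(\<Prod>i\<in>UNIV - {l}. \<integral>z. e i z \<partial>lborel) = ?I"
      by (intro prod.cong refl) (simp add: e_def integral_bump)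
    finally show ?thesis by (simp add: e_def)
  qed
  have "integral\<^sup>L lebesgue (\<lambda>z. u z * dzbar k (\<eta> n) z) = - ((\<integral>z. b n z * P z \<partial>lborel) * ?I)" for n
    using u_eq test[of n] unfolding dbar_eq_def rhs[symmetric] by blast
  then have "(\<lambda>n. integral\<^sup>L lebesgue (\<lambda>z. u z * dzbar k (\<eta> n) z)) \<longlonglongrightarrow>
      - ((\<integral>z. bump 1 0 * P z \<partial>lborel) * ?I)"
    by (simp only:) (intro tendsto_intros bP_lim)
  from LIMSEQ_unique[OF lhs this]
  have "bump 1 0 * integral\<^sup>L lebesgue (\<lambda>z. u z * ?K z) = bump 1 0 * (- (L2_inner (\<phi> l) f g * ?I))"
    by (simp add: P_inner)
  from mult_left_cancel[OF bump_1_0, THEN iffD1, OF this] show ?thesis .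
qed

theorem proposition6p5:
  fixes \<phi> :: "'n::finite \<Rightarrow> complex \<Rightarrow> real" and k l :: 'n
  assumes "CARD('n) \<ge> 2"
    and "\<And>j. C_infinity (\<phi> j)"
    and "infinite_dimensional (A2_1 (\<phi> l))"
    and "\<And>j. (\<lambda>_. 1) \<in> L2 (\<phi> j)"
    and "k \<noteq> l"
    and "cnj \<in> L2 (\<phi> k)"
  shows "\<not> canonical_solution_compact_on (sum_weight \<phi>) (A2_01 (sum_weight \<phi>))"
proof
  let ?\<Phi> = "sum_weight \<phi>"
  assume compact: "canonical_solution_compact_on ?\<Phi> (A2_01 ?\<Phi>)"
  have \<phi>: "continuous_on UNIV (\<phi> j)" for j
    using assms(2) C_k_imp_continuous unfolding C_infinity_def by blast
  obtain f :: "nat \<Rightarrow> complex \<Rightarrow> complex" where f: "\<And>m. f m \<in> A2_1 (\<phi> l)"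
    and ortho: "\<And>m p. L2_inner (\<phi> l) (f m) (f p) = (if m = p then 1 else 0)"
    by (rule orthonormal_sequence_exists[OF \<phi> assms(3)]) (rule that)
  have unit: "L2_sq (\<phi> l) (f m) = 1" for m
    using ortho[of m m] unfolding L2_inner_self by (simp only: refl if_True of_real_eq_1_iff)
  define F where "F m = coord_form k l (f m)" for m
  note sol = canonical_solution_coord_form[of \<phi>, OF \<phi> assms(4,5,6) f, folded F_def]
  have "F m \<in> A2_01 ?\<Phi> \<inter> canonical_domain ?\<Phi>" for m
    using coord_form_A2_01[of \<phi>, OF \<phi> assms(4) f] sol(1) by (simp add: F_def)
  moreover have "\<exists>C. \<forall>m. L2_01_norm ?\<Phi> (F m) \<le> C"
    unfolding F_def L2_01_norm_coord_form L2_sq_coord[of \<phi>, OF \<phi> assms(4) f] unit by blast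
  ultimately obtain g r where g: "g \<in> L2 ?\<Phi>" and r: "strict_mono r"
    and lim: "(\<lambda>m. L2_norm ?\<Phi> (\<lambda>z. canonical_solution ?\<Phi> (F (r m)) z - g z)) \<longlonglongrightarrow> 0"
    using compact unfolding canonical_solution_compact_on_def by blast
  define v where "v m = canonical_solution ?\<Phi> (F (r m))" for m
  define a where "a m = L2_sq ?\<Phi> (\<lambda>z. v m z - g z)" for m
  define K where "K m = pairing_kernel \<phi> k l (f (r m))" for m
  define C where "C = (\<Prod>i\<in>UNIV. if i = l then 1
         else L2_sq (\<lambda>z. - \<phi> i z) (if i = k then dzbar_1 (bump 1) else bump 1))"
  define M where "M = (\<Prod>i\<in>UNIV - {l}. bump_mass 1)"
  have M: "0 < M" unfolding M_def by (intro prod_pos) (simp add: bump_mass_pos)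
  have C: "0 \<le> C" unfolding C_def by (intro prod_nonneg) simp
  have v: "v m \<in> L2 ?\<Phi>" "dbar_eq (v m) (F (r m))" for m
    using sol(2)[of "r m"] unfolding v_def is_canonical_solution_def by blast+
  have \<Phi>: "continuous_on UNIV ?\<Phi>" by (rule continuous_sum_weight[of \<phi>, OF \<phi>])
  have d: "(\<lambda>z. v m z - g z) \<in> L2 ?\<Phi>" for m
    using L2_add_mult[OF \<Phi> v(1) g, of m "-1"] by simp
  have K: "K m \<in> L2 (\<lambda>z. - ?\<Phi> z)" "L2_sq (\<lambda>z. - ?\<Phi> z) (K m) = C" for m
    unfolding K_def L2_sq_pairing_kernel[of \<phi>, OF \<phi> f] unit C_def
    by (rule pairing_kernel_L2[of \<phi>, OF \<phi> f]) (rule refl)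
  have pair: "integral\<^sup>L lebesgue (\<lambda>z. v p z * K m z) = (if p = m then - of_real M else 0)" for p m
    unfolding K_def
    using pairing_identity[of \<phi> k l, OF assms(2,5) f f v(1) v(2)[unfolded F_def], of p "r m"]
      strict_mono_eq[OF r, of p m]
    by (simp add: ortho M_def)
  \<comment> \<open>Pair the difference of two solutions with the kernel of one of them: the pairing is \<open>\<plusminus> M\<close>, whereas it
    is small if both solutions are close to \<open>g\<close>.\<close>
  have separation: "M \<le> s * (a m + a p) + 2 * C / s" if "m \<noteq> p" "0 < s" for m p s
  proof -
    have diff: "integral\<^sup>L lebesgue (\<lambda>z. (v q z - g z) * K m z) =
        integral\<^sup>L lebesgue (\<lambda>z. v q z * K m z) - integral\<^sup>L lebesgue (\<lambda>z. g z * K m z)" for q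
      using L2_pairing_integrable[OF \<Phi> v(1) K(1)] L2_pairing_integrable[OF \<Phi> g K(1)]
      by (simp add: left_diff_distrib)
    have bound: "cmod (integral\<^sup>L lebesgue (\<lambda>z. (v q z - g z) * K m z)) \<le> s * a q + C / s" for q
      using L2_pairing_bound[OF \<Phi> d K(1) \<open>0 < s\<close>] unfolding K(2) a_def[symmetric] .
    have "complex_of_real M = integral\<^sup>L lebesgue (\<lambda>z. (v p z - g z) * K m z)
        - integral\<^sup>L lebesgue (\<lambda>z. (v m z - g z) * K m z)"
      unfolding diff pair using \<open>m \<noteq> p\<close> by simp
    then have "cmod (of_real M) \<le> cmod (integral\<^sup>L lebesgue (\<lambda>z. (v p z - g z) * K m z))
        + cmod (integral\<^sup>L lebesgue (\<lambda>z. (v m z - g z) * K m z))"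
      by (simp only: norm_triangle_ineq4)
    also have "\<dots> \<le> (s * a p + C / s) + (s * a m + C / s)"
      by (rule add_mono[OF bound bound])
    finally show ?thesis using M by (simp add: algebra_simps)
  qed
  have "a \<longlonglongrightarrow> 0"
  proof -
    have "a = (\<lambda>m. (L2_norm ?\<Phi> (\<lambda>z. v m z - g z))\<^sup>2)"
      by (simp add: a_def L2_norm_def fun_eq_iff)
    moreover have "(\<lambda>m. (L2_norm ?\<Phi> (\<lambda>z. v m z - g z))\<^sup>2) \<longlonglongrightarrow> 0\<^sup>2"
      using lim unfolding v_def by (rule tendsto_power)
    ultimately show ?thesis by simp
  qed
  \<comment> \<open>Large enough that the fixed term \<open>2 C / s\<close> uses up less than half of \<open>M\<close>; adding \<open>1\<close> keeps \<open>s\<close> positive.\<close>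
  define s where "s = 4 * (C + 1) / M"
  have s: "0 < s" using M C by (simp add: s_def)
  have "2 * C / s < M / 2"
    using M C by (simp add: s_def field_simps)
  have "\<forall>\<^sub>F m in sequentially. a m < M / (4 * s)"
    by (rule order_tendstoD(2)[OF \<open>a \<longlonglongrightarrow> 0\<close>]) (use M s in simp)
  then obtain m where m: "a m < M / (4 * s)" "a (Suc m) < M / (4 * s)"
    unfolding eventually_sequentially by (metis le_Suc_eq order_refl)
  then have "s * (a m + a (Suc m)) < M / 2"
    using s by (simp add: field_simps)
  with separation[of m "Suc m" s] s \<open>2 * C / s < M / 2\<close> show False by simp
qed

end
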